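(* Let $\lambda_1,\lambda_2,\mu_1,\mu_2,\mu_3>0$ with $\rho_1+\rho_2<1$, where $\rho_i=\lambda_i/\mu_i$, let $N\ge 1$ be an integer, and let $\omega>0$. For small $\varepsilon>0$ set $$\lambda_3=\mu_3(1-\rho_1-\rho_2)-\varepsilon\omega,$$ and let $X_1,X_2,X_3$ be the steady-state queue lengths of the three-queue threshold priority polling system described in the context, with these parameters. Then for all integers $x_1,x_2\ge 0$ and all $\zeta>0$, $$\lim_{\varepsilon\downarrow 0}\mathbb{P}\{X_1\le x_1,\ X_2\le x_2,\ \varepsilon X_3\le\zeta\}=\mathcal{L}(x_1,x_2)\,\bigl(1-\mathrm{e}^{-\eta\zeta}\bigr),$$ where $\eta>0$ is defined by $$\frac{\omega}{\eta}=\mu_3\left[1-\rho_1-\rho_2+\frac{\mu_3}{\mu_1}\rho_1+\frac{\mu_3}{\mu_2}\rho_2\right],$$ and $\mathcal{L}(\cdot,\cdot)$ is the joint cumulative distribution function of the stationary numbers of high-priority and low-priority customers in Model II (the preemptive priority polling system with $N$-policy vacation described in the context).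
   Context: Threshold priority polling system. A single server serves three queues $Q_1,Q_2,Q_3$ with infinite buffers. Type $i$ customers arrive at $Q_i$ according to independent Poisson processes with rates $\lambda_i$, and have i.i.d. exponential service times with rate $\mu_i$; arrivals and services are independent; each queue is served FCFS. Put $\rho_i=\lambda_i/\mu_i$ and $\rho=\rho_1+\rho_2+\rho_3$; the system is ergodic when $\rho<1$. Service discipline: (1) $Q_1$ is served exhaustively: the server serves $Q_1$ until it is empty and then switches to $Q_2$. (2) While the server is serving $Q_2$, if a type 1 customer arrives the server switches to $Q_1$ immediately; otherwise it continues serving $Q_2$ until $Q_2$ is empty and then switches to $Q_3$. (3) While the server is serving $Q_3$: if a type 1 customer arrives, it switches to $Q_1$ immediately; if the size of $Q_2$ reaches the threshold $N$ and $Q_1$ is empty, it switches to $Q_2$ immediately; otherwise it continues serving $Q_3$ until $Q_3$ is empty and then switches to $Q_2$. All switches are instantaneous (an empty queue is left immediately, so the server idles only when the whole system is empty, in which case the next arriving customer is served at once). An interrupted customer returns to the head of its queue and its service restarts from the beginning. $X_i$ denotes the steady-state number of customers in $Q_i$ (including any in service). Model II. Two classes of customers, high-priority and low-priority, arrive according to independent Poisson processes with rates $\lambda_1$ and $\lambda_2$; their service times are exponential with rates $\mu_1$ and $\mu_2$ respectively, all independent of each other and of the arrivals. Each class is served FCFS by a single server, with high-priority customers having preemptive priority over low-priority ones. The server takes a vacation once the system becomes empty, and goes back to work as soon as either the number of low-priority customers reaches $N$ or a high-priority customer arrives; it then works until the system is empty again. *)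

theory Defs
  imports "HOL-Probability.Probability"
begin

text \<open>
  Continuous-time Markov chains are given by their transition rates \<open>q s s'\<close> from \<open>s\<close> to \<open>s'\<close>
  (for \<open>s \<noteq> s'\<close>; a rate from a state to itself would cancel in the balance equation).
  A stationary distribution is a probability distribution that is a time-constant solution
  of the Kolmogorov forward equations. For the chains below all exit rates are bounded, so this is
  the same as invariance under the transition semigroup.
\<close>

definition stationary :: "('s \<Rightarrow> 's \<Rightarrow> real) \<Rightarrow> 's pmf \<Rightarrow> bool" where
  "stationary q p \<longleftrightarrow>
     (\<forall>s. ((\<lambda>s'. pmf p s' * q s' s) has_sum (pmf p s * (\<Sum>\<^sub>\<infinity>s'. q s s'))) UNIV)"


subsection \<open>The three-queue threshold priority polling system\<close>

datatype server = At1 | At2 | At3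

text \<open>A single switching decision of the server, given the queue lengths.\<close>

fun switch :: "nat \<Rightarrow> server \<Rightarrow> nat \<times> nat \<times> nat \<Rightarrow> server" where
  "switch N At1 (x1, x2, x3) = (if x1 > 0 then At1 else At2)"
| "switch N At2 (x1, x2, x3) = (if x1 > 0 then At1 else if x2 > 0 then At2 else At3)"
| "switch N At3 (x1, x2, x3) =
     (if x1 > 0 then At1 else if x2 \<ge> N then At2 else if x3 > 0 then At3 else At2)"

text \<open>
  Switches are instantaneous, so after an event the server switches until it rests at a nonempty
  queue; two decisions always suffice (see \<open>switch_settle\<close>). In an empty system the server idles.
  The position \<open>At1\<close> recorded then is a mere convention: from any position, the next arriving
  customer would be served at once (see \<open>settle_from_empty\<close>).
\<close>

definition settle :: "nat \<Rightarrow> server \<Rightarrow> nat \<times> nat \<times> nat \<Rightarrow> server" where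
  "settle N p x = (if x = (0, 0, 0) then At1 else switch N (switch N p x) x)"

lemma switch_settle:
  assumes "N \<ge> 1" and "x \<noteq> (0, 0, 0)"
  shows "switch N (settle N p x) x = settle N p x"
  using assms by (cases x; cases p) (auto simp: settle_def)

lemma settle_from_empty:
  assumes "N \<ge> 1"
  shows "settle N p (1, 0, 0) = At1" "settle N p (0, 1, 0) = At2" "settle N p (0, 0, 1) = At3"
  using assms by (cases p; simp add: settle_def)+

text \<open>
  A state consists of the position of the server and the three queue lengths, including the
  customer in service. By the memoryless property of the exponential service times, restarting
  interrupted services requires no further component. States whose server position
  contradicts the discipline are never entered, so a stationary distribution gives them
  probability 0.
\<close>

type_synonym polling_state = "server \<times> nat \<times> nat \<times> nat"

definition polling_move :: "nat \<Rightarrow> server \<Rightarrow> nat \<times> nat \<times> nat \<Rightarrow> polling_state" where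
  "polling_move N p x = (settle N p x, x)"

definition polling_rate ::
  "nat \<Rightarrow> real \<Rightarrow> real \<Rightarrow> real \<Rightarrow> real \<Rightarrow> real \<Rightarrow> real \<Rightarrow> polling_state \<Rightarrow> polling_state \<Rightarrow> real" where
  "polling_rate N lam1 lam2 lam3 mu1 mu2 mu3 = (\<lambda>(p, x1, x2, x3) s'.
       lam1 * of_bool (s' = polling_move N p (x1 + 1, x2, x3))
     + lam2 * of_bool (s' = polling_move N p (x1, x2 + 1, x3))
     + lam3 * of_bool (s' = polling_move N p (x1, x2, x3 + 1))
     + mu1 * of_bool (p = At1 \<and> x1 > 0 \<and> s' = polling_move N p (x1 - 1, x2, x3))
     + mu2 * of_bool (p = At2 \<and> x2 > 0 \<and> s' = polling_move N p (x1, x2 - 1, x3))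
     + mu3 * of_bool (p = At3 \<and> x3 > 0 \<and> s' = polling_move N p (x1, x2, x3 - 1)))"


subsection \<open>The preemptive priority system with N-policy vacation\<close>

datatype mode = Working | Vacation

type_synonym vacation_state = "mode \<times> nat \<times> nat"

text \<open>
  The components \<open>h\<close> and \<open>l\<close> are the numbers of high- and low-priority customers. As above,
  states violating the vacation rule are never entered.
\<close>

fun vacation_move :: "nat \<Rightarrow> mode \<Rightarrow> nat \<times> nat \<Rightarrow> vacation_state" where
  "vacation_move N Working (h, l) = (if h = 0 \<and> l = 0 then Vacation else Working, h, l)"
| "vacation_move N Vacation (h, l) = (if h > 0 \<or> l \<ge> N then Working else Vacation, h, l)"

definition vacation_rate ::
  "nat \<Rightarrow> real \<Rightarrow> real \<Rightarrow> real \<Rightarrow> real \<Rightarrow> vacation_state \<Rightarrow> vacation_state \<Rightarrow> real" where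
  "vacation_rate N lam1 lam2 mu1 mu2 = (\<lambda>(m, h, l) s'.
       lam1 * of_bool (s' = vacation_move N m (h + 1, l))
     + lam2 * of_bool (s' = vacation_move N m (h, l + 1))
     + mu1 * of_bool (m = Working \<and> h > 0 \<and> s' = vacation_move N m (h - 1, l))
     + mu2 * of_bool (m = Working \<and> h = 0 \<and> l > 0 \<and> s' = vacation_move N m (h, l - 1)))"

definition vacation_cdf :: "vacation_state pmf \<Rightarrow> nat \<Rightarrow> nat \<Rightarrow> real" where
  "vacation_cdf p x1 x2 = measure_pmf.prob p {(m, h, l). h \<le> x1 \<and> l \<le> x2}"

end

theory Submission
  imports Defs "HOL-Complex_Analysis.Great_Picard"
begin

text \<open>
  Let \<open>W = X1 / mu1 + X2 / mu2\<close> be the expected work in the first two queues and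
  \<open>b = 1 - lam1 / mu1 - lam2 / mu2\<close>. Stationarity is used through the generator \<open>L\<close>: the
  expectation of \<open>L f\<close> is \<open>0\<close> for every integrable \<open>f\<close>
  (\<open>stationary_generator\<close>). The proof determines the limit of the expectations of
  \<open>indicator A (X1, X2) * exp (- k * \<epsilon> * X3)\<close> for all natural numbers \<open>k\<close>, in
  two parts.

  Laplace transform of the third queue. The drift of \<open>W\<close> does not depend on the queue lengths but
  only on whether the server works at one of the first two queues. With \<open>z = exp (- k * \<epsilon>)\<close>,
  the test functions \<open>z ^ X3\<close>, \<open>W * z ^ X3\<close>, \<open>W\<^sup>2 * z ^ X3\<close>,
  \<open>X1 * z ^ X3\<close> and \<open>X2 * z ^ X3\<close> therefore give identities that form a closed system up
  to terms that vanish with \<open>\<epsilon>\<close> (\<open>work_identity\<close>,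
  \<open>work_squared_identity\<close>, \<open>rate_identities\<close>). Solving it gives the limit
  \<open>\<eta> / (\<eta> + k)\<close> of the expectation of \<open>z ^ X3\<close>, the Laplace transform of the
  exponential law (\<open>laplace_limit\<close>). The error terms are controlled by a moment bound on
  \<open>exp (\<delta> * W)\<close> uniform in \<open>\<epsilon>\<close>, which follows from a drift condition:
  \<open>W\<close> decreases on average unless the server is at the third queue or idle, and then \<open>W\<close>
  is bounded through the threshold \<open>N\<close> (\<open>exp_moment\<close>).

  Averaging for the first two queues. By \<open>laplace_limit\<close>, the probability of
  \<open>X3 \<le> 1\<close> is asymptotically at most \<open>\<eta> / (\<eta> + k)\<close> for every
  \<open>k\<close>, so it tends to \<open>0\<close>. While \<open>X3 \<ge> 2\<close>, the first two queues move
  exactly as Model II, the server at the third queue being on vacation. So their law under the measure reweighted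
  by \<open>z ^ X3\<close> asymptotically satisfies the stationarity equations of Model II. The exponential moment
  provides compactness, and Model II has only one stationary law, because from every state it can reach the empty
  one; hence the reweighted law converges to that of Model II (\<open>front_tendsto\<close>).

  The product of both limits is \<open>\<eta> / (\<eta> + k)\<close> times the probability of \<open>A\<close> in
  Model II (\<open>joint_moments\<close>). These are the moments of a variable in \<open>[0, 1]\<close>, and by
  the Weierstrass approximation theorem they determine the limit of the distribution functions
  (\<open>exponential_cdf_of_moments\<close>).
\<close>

section \<open>Stationarity through the generator\<close>

text \<open>
  Both chains are given by finitely many kinds of events (arrivals and services). An event is a pair of a
  state-dependent rate and the map to the next state. In this form the generator applied to a function is a finite
  sum, which the simplifier can compute for concrete chains.
\<close>

type_synonym 's move = "('s \<Rightarrow> real) \<times> ('s \<Rightarrow> 's)"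

definition jump_rate :: "'s move list \<Rightarrow> 's \<Rightarrow> 's \<Rightarrow> real" where
  "jump_rate ms s s' = (\<Sum>(r, t)\<leftarrow>ms. r s * of_bool (s' = t s))"

definition exit_rate :: "'s move list \<Rightarrow> 's \<Rightarrow> real" where
  "exit_rate ms s = (\<Sum>(r, t)\<leftarrow>ms. r s)"

definition generator :: "'s move list \<Rightarrow> ('s \<Rightarrow> real) \<Rightarrow> 's \<Rightarrow> real" where
  "generator ms f s = (\<Sum>(r, t)\<leftarrow>ms. r s * (f (t s) - f s))"

definition bounded_moves :: "'s move list \<Rightarrow> bool" where
  "bounded_moves ms \<longleftrightarrow> (\<forall>(r, t) \<in> set ms. (\<forall>s. 0 \<le> r s) \<and> (\<exists>B. \<forall>s. r s \<le> B))"

lemma has_sum_jump_rate: "((\<lambda>s'. jump_rate ms s s') has_sum exit_rate ms s) UNIV"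
proof (induction ms)
  case Nil
  then show ?case by (simp add: jump_rate_def exit_rate_def)
next
  case (Cons m ms)
  obtain r t where m: "m = (r, t)" by (cases m)
  have "((\<lambda>s'. r s * of_bool (s' = t s)) has_sum r s) UNIV"
    by (rule has_sum_finite_neutralI[where B = "{t s}"]) auto
  from has_sum_add[OF this Cons.IH] show ?case
    by (simp add: jump_rate_def exit_rate_def m)
qed

lemma infsum_jump_rate: "(\<Sum>\<^sub>\<infinity>s'. jump_rate ms s s') = exit_rate ms s"
  using has_sum_jump_rate by (rule infsumI)

lemma nn_integral_has_sum:
  fixes g :: "'s \<Rightarrow> real"
  assumes "(g has_sum c) UNIV" and nonneg: "\<And>s. 0 \<le> g s"
  shows "(\<integral>\<^sup>+ s. ennreal (g s) \<partial>count_space UNIV) = ennreal c"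
proof -
  have "g summable_on UNIV"
    using assms(1) by (auto simp: summable_on_def)
  then have "Infinite_Set_Sum.abs_summable_on g UNIV"
    using summable_on_iff_abs_summable_on_real abs_summable_equivalent by blast
  moreover from this have "infsetsum g UNIV = c"
    using infsetsum_infsum assms(1) by (metis infsumI)
  ultimately show ?thesis
    using nonneg
    by (subst nn_integral_eq_integral)
       (auto simp: Infinite_Set_Sum.abs_summable_on_def infsetsum_def)
qed

lemma nn_integral_sum_list:
  assumes "\<And>x. x \<in> set xs \<Longrightarrow> f x \<in> borel_measurable M"
  shows "(\<integral>\<^sup>+ s. (\<Sum>x\<leftarrow>xs. f x s) \<partial>M) = (\<Sum>x\<leftarrow>xs. \<integral>\<^sup>+ s. f x s \<partial>M)"
  using assms
proof (induction xs)
  case (Cons a xs)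
  have "(\<lambda>s. \<Sum>x\<leftarrow>xs. f x s) \<in> borel_measurable M"
  proof -
    have "(\<lambda>s. \<Sum>x\<leftarrow>ys. f x s) \<in> borel_measurable M" if "set ys \<subseteq> set xs" for ys
      using that Cons.prems by (induction ys) auto
    then show ?thesis by blast
  qed
  with Cons show ?case by (simp add: nn_integral_add)
qed simp

lemma ennreal_sum_list:
  assumes "\<And>x. x \<in> set xs \<Longrightarrow> 0 \<le> f x"
  shows "ennreal (\<Sum>x\<leftarrow>xs. f x) = (\<Sum>x\<leftarrow>xs. ennreal (f x))"
  using assms
proof (induction xs)
  case (Cons a xs)
  have "0 \<le> (\<Sum>x\<leftarrow>xs. f x)"
    using Cons.prems by (intro sum_list_nonneg) auto
  with Cons show ?case by (simp add: ennreal_plus)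
qed simp

text \<open>
  The balance equation at a single state is multiplied by the weight of the state and summed over all states. With
  values in \<open>ennreal\<close> the two sums may be exchanged without any summability condition.
\<close>

lemma nn_flow_balance:
  fixes F :: "'s \<Rightarrow> ennreal"
  assumes st: "stationary (jump_rate ms) p" and ms: "bounded_moves ms"
  shows "(\<Sum>(r, t)\<leftarrow>ms. \<integral>\<^sup>+ s. ennreal (r s) * F (t s) \<partial>p)
       = (\<integral>\<^sup>+ s. ennreal (exit_rate ms s) * F s \<partial>p)"
proof -
  have r: "0 \<le> r s" if "(r, t) \<in> set ms" for r t s
    using that ms by (auto simp: bounded_moves_def)
  have jr: "ennreal (jump_rate ms s' s) = (\<Sum>(r, t)\<leftarrow>ms. ennreal (r s') * of_bool (s = t s'))" for s s'
    unfolding jump_rate_def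
    by (subst ennreal_sum_list)
       (auto simp: r case_prod_unfold ennreal_mult of_bool_def intro!: arg_cong[where f = sum_list])
  have nn: "0 \<le> jump_rate ms s' s" for s s'
    unfolding jump_rate_def by (auto intro!: sum_list_nonneg simp: r)
  have inflow: "(\<integral>\<^sup>+ s'. ennreal (pmf p s') * ennreal (jump_rate ms s' s) \<partial>count_space UNIV)
      = ennreal (pmf p s) * ennreal (exit_rate ms s)" for s
  proof -
    have "((\<lambda>s'. pmf p s' * jump_rate ms s' s) has_sum (pmf p s * exit_rate ms s)) UNIV"
      using st by (simp add: stationary_def infsum_jump_rate)
    from nn_integral_has_sum[OF this] nn
    show ?thesis by (simp add: ennreal_mult')
  qed
  have "(\<Sum>(r, t)\<leftarrow>ms. \<integral>\<^sup>+ s. ennreal (r s) * F (t s) \<partial>p)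
      = (\<integral>\<^sup>+ s'. (\<Sum>(r, t)\<leftarrow>ms. ennreal (r s') * F (t s')) \<partial>p)"
    by (subst nn_integral_sum_list) (auto simp: case_prod_unfold)
  also have "\<dots> = (\<integral>\<^sup>+ s'. (\<integral>\<^sup>+ s. ennreal (jump_rate ms s' s) * F s \<partial>count_space UNIV) \<partial>p)"
  proof (rule nn_integral_cong)
    fix s'
    have single: "(\<integral>\<^sup>+ s. ennreal (r s') * of_bool (s = t s') * F s \<partial>count_space UNIV)
        = ennreal (r s') * F (t s')" for r :: "'s \<Rightarrow> real" and t
    proof -
      have "(\<integral>\<^sup>+ s. ennreal (r s') * of_bool (s = t s') * F s \<partial>count_space UNIV)
          = (\<integral>\<^sup>+ s. (ennreal (r s') * F (t s')) * indicator {t s'} s \<partial>count_space UNIV)"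
        by (intro nn_integral_cong) (auto simp: indicator_def)
      then show ?thesis by (simp add: nn_integral_cmult_indicator)
    qed
    have "(\<integral>\<^sup>+ s. ennreal (jump_rate ms s' s) * F s \<partial>count_space UNIV)
       = (\<integral>\<^sup>+ s. (\<Sum>(r, t)\<leftarrow>ms. ennreal (r s') * of_bool (s = t s') * F s) \<partial>count_space UNIV)"
      unfolding jr by (simp add: sum_list_mult_const case_prod_unfold flip: sum_list_mult_const)
    also have "\<dots> = (\<Sum>(r, t)\<leftarrow>ms. ennreal (r s') * F (t s'))"
      by (subst nn_integral_sum_list) (auto simp: case_prod_unfold single)
    finally show "(\<Sum>(r, t)\<leftarrow>ms. ennreal (r s') * F (t s'))
       = (\<integral>\<^sup>+ s. ennreal (jump_rate ms s' s) * F s \<partial>count_space UNIV)" by simp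
  qed
  also have "\<dots> = (\<integral>\<^sup>+ s'. (\<integral>\<^sup>+ s. ennreal (pmf p s') * ennreal (jump_rate ms s' s) * F s
      \<partial>count_space UNIV) \<partial>count_space UNIV)"
    by (simp add: nn_integral_measure_pmf nn_integral_cmult mult.assoc)
  also have "\<dots> = (\<integral>\<^sup>+ s. (\<integral>\<^sup>+ s'. ennreal (pmf p s') * ennreal (jump_rate ms s' s) * F s
      \<partial>count_space UNIV) \<partial>count_space UNIV)"
    using nn_integral_fst_count_space[of "\<lambda>(s', s). ennreal (pmf p s') * ennreal (jump_rate ms s' s) * F s"]
      nn_integral_snd_count_space[of "\<lambda>(s', s). ennreal (pmf p s') * ennreal (jump_rate ms s' s) * F s"]
    by simp
  also have "\<dots> = (\<integral>\<^sup>+ s. ennreal (exit_rate ms s) * F s \<partial>p)"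
    by (subst nn_integral_multc) (auto simp: inflow nn_integral_measure_pmf mult.assoc)
  finally show ?thesis .
qed

lemma exit_rate_bounded:
  assumes "bounded_moves ms"
  shows "\<exists>B. \<forall>s. exit_rate ms s \<le> B"
  using assms
proof (induction ms)
  case (Cons m ms)
  obtain r t where m: "m = (r, t)" by (cases m)
  obtain B where "\<forall>s. exit_rate ms s \<le> B"
    using Cons by (auto simp: bounded_moves_def)
  moreover obtain B' where "\<forall>s. r s \<le> B'"
    using Cons.prems by (auto simp: bounded_moves_def m)
  ultimately have "\<forall>s. exit_rate (m # ms) s \<le> B' + B"
    by (auto simp: exit_rate_def m intro: add_mono)
  then show ?case by blast
qed (auto simp: exit_rate_def)

lemma exit_rate_nonneg: "bounded_moves ms \<Longrightarrow> 0 \<le> exit_rate ms s"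
  by (fastforce simp: exit_rate_def bounded_moves_def intro!: sum_list_nonneg)

lemma integrable_sum_list:
  fixes f :: "'i \<Rightarrow> 's \<Rightarrow> real"
  assumes "\<And>x. x \<in> set xs \<Longrightarrow> integrable M (f x)"
  shows "integrable M (\<lambda>s. \<Sum>x\<leftarrow>xs. f x s)"
    and "(\<integral>s. (\<Sum>x\<leftarrow>xs. f x s) \<partial>M) = (\<Sum>x\<leftarrow>xs. \<integral>s. f x s \<partial>M)"
proof -
  show *: "integrable M (\<lambda>s. \<Sum>x\<leftarrow>xs. f x s)"
    using assms by (induction xs) auto
  have "integrable M (\<lambda>s. \<Sum>x\<leftarrow>ys. f x s) \<and>
     (\<integral>s. (\<Sum>x\<leftarrow>ys. f x s) \<partial>M) = (\<Sum>x\<leftarrow>ys. \<integral>s. f x s \<partial>M)" if "set ys \<subseteq> set xs" for ys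
    using that assms by (induction ys) auto
  then show "(\<integral>s. (\<Sum>x\<leftarrow>xs. f x s) \<partial>M) = (\<Sum>x\<leftarrow>xs. \<integral>s. f x s \<partial>M)" by simp
qed

lemma integrable_exit_rate_mult:
  fixes p :: "'s pmf"
  assumes ms: "bounded_moves ms" and f: "integrable p f"
  shows "integrable p (\<lambda>s. exit_rate ms s * f s)"
proof -
  obtain B where B: "exit_rate ms s \<le> B" for s
    using exit_rate_bounded[OF ms] by blast
  show ?thesis
  proof (rule Bochner_Integration.integrable_bound)
    show "integrable p (\<lambda>s. B * \<bar>f s\<bar>)"
      using f by simp
    show "AE s in p. norm (exit_rate ms s * f s) \<le> norm (B * \<bar>f s\<bar>)"
    proof (rule AE_I2)
      fix s
      have "exit_rate ms s * \<bar>f s\<bar> \<le> B * \<bar>f s\<bar>"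
        using B by (intro mult_right_mono) auto
      with exit_rate_nonneg[OF ms, of s]
      show "norm (exit_rate ms s * f s) \<le> norm (B * \<bar>f s\<bar>)"
        by (auto simp: abs_mult intro: order_trans[OF _ mult_right_mono[OF abs_ge_self[of B]]])
    qed
  qed simp
qed

lemma integrable_move:
  fixes p :: "'s pmf"
  assumes st: "stationary (jump_rate ms) p" and ms: "bounded_moves ms"
    and f: "integrable p f" and rt: "(r, t) \<in> set ms"
  shows "integrable p (\<lambda>s. r s * f (t s))"
proof (rule integrableI_bounded)
  have r: "0 \<le> r s" for s
    using rt ms by (auto simp: bounded_moves_def)
  have *: "(\<integral>\<^sup>+ s. ennreal (exit_rate ms s) * ennreal \<bar>f s\<bar> \<partial>p) < \<infinity>"
    using integrable_exit_rate_mult[OF ms f] exit_rate_nonneg[OF ms]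
    by (simp add: integrable_iff_bounded abs_mult ennreal_mult)
  have "(\<integral>\<^sup>+ s. ennreal (norm (r s * f (t s))) \<partial>p)
      = (case (r, t) of (r, t) \<Rightarrow> \<integral>\<^sup>+ s. ennreal (r s) * ennreal \<bar>f (t s)\<bar> \<partial>p)"
    using r by (simp add: abs_mult ennreal_mult)
  also have "\<dots> \<le> (\<Sum>(r, t)\<leftarrow>ms. \<integral>\<^sup>+ s. ennreal (r s) * ennreal \<bar>f (t s)\<bar> \<partial>p)"
    using rt by (intro member_le_sum_list) (auto simp: image_iff intro!: bexI[of _ "(r, t)"])
  also have "\<dots> < \<infinity>"
    using nn_flow_balance[OF st ms, of "\<lambda>s. ennreal \<bar>f s\<bar>"] * by simp
  finally show "(\<integral>\<^sup>+ s. ennreal (norm (r s * f (t s))) \<partial>p) < \<infinity>" .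
qed simp

lemma flow_balance_nonneg:
  fixes p :: "'s pmf"
  assumes st: "stationary (jump_rate ms) p" and ms: "bounded_moves ms"
    and f: "integrable p f" and nonneg: "\<And>s. 0 \<le> f s"
  shows "(\<Sum>(r, t)\<leftarrow>ms. \<integral>s. r s * f (t s) \<partial>p) = (\<integral>s. exit_rate ms s * f s \<partial>p)"
proof -
  have r: "0 \<le> r s" if "(r, t) \<in> set ms" for r t s
    using that ms by (auto simp: bounded_moves_def)
  have "ennreal (\<Sum>(r, t)\<leftarrow>ms. \<integral>s. r s * f (t s) \<partial>p)
      = (\<Sum>(r, t)\<leftarrow>ms. \<integral>\<^sup>+ s. ennreal (r s) * ennreal (f (t s)) \<partial>p)"
  proof (subst ennreal_sum_list)
    show "0 \<le> (case x of (r, t) \<Rightarrow> \<integral>s. r s * f (t s) \<partial>p)" if "x \<in> set ms" for x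
      using that nonneg r by (auto intro!: Bochner_Integration.integral_nonneg split: prod.split)
    have "ennreal (\<integral>s. r s * f (t s) \<partial>p) = (\<integral>\<^sup>+ s. ennreal (r s) * ennreal (f (t s)) \<partial>p)"
      if "(r, t) \<in> set ms" for r t
      using integrable_move[OF st ms f that] r[OF that] nonneg
      by (subst nn_integral_eq_integral[symmetric]) (auto simp: ennreal_mult)
    then show "(\<Sum>x\<leftarrow>ms. ennreal (case x of (r, t) \<Rightarrow> \<integral>s. r s * f (t s) \<partial>p))
       = (\<Sum>(r, t)\<leftarrow>ms. \<integral>\<^sup>+ s. ennreal (r s) * ennreal (f (t s)) \<partial>p)"
      by (intro arg_cong[where f = sum_list] map_cong) auto
  qed
  also have "\<dots> = (\<integral>\<^sup>+ s. ennreal (exit_rate ms s) * ennreal (f s) \<partial>p)"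
    by (rule nn_flow_balance[OF st ms])
  also have "\<dots> = ennreal (\<integral>s. exit_rate ms s * f s \<partial>p)"
    using integrable_exit_rate_mult[OF ms f] nonneg exit_rate_nonneg[OF ms]
    by (subst nn_integral_eq_integral[symmetric]) (auto simp: ennreal_mult)
  finally show ?thesis
    using nonneg exit_rate_nonneg[OF ms] r
    by (subst (asm) ennreal_inj) (auto intro!: sum_list_nonneg Bochner_Integration.integral_nonneg)
qed

lemma generator_eq: "generator ms f s = (\<Sum>(r, t)\<leftarrow>ms. r s * f (t s)) - exit_rate ms s * f s"
  by (induction ms) (auto simp: generator_def exit_rate_def algebra_simps)

text \<open>
  This is the form in which stationarity is used everywhere below: the expectation of the generator vanishes also
  on unbounded functions. Integrability of \<open>f\<close> is enough, because by \<open>nn_flow_balance\<close>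
  the inflow terms \<open>r s * f (t s)\<close> have the same total mass as the outflow.
\<close>

theorem stationary_generator:
  fixes p :: "'s pmf"
  assumes st: "stationary (jump_rate ms) p" and ms: "bounded_moves ms"
    and f: "integrable p f"
  shows "integrable p (generator ms f)" and "measure_pmf.expectation p (generator ms f) = 0"
proof -
  have int: "integrable p (\<lambda>s. case x of (r, t) \<Rightarrow> r s * g (t s))"
    if x: "x \<in> set ms" and g: "integrable p g" for x g
  proof -
    obtain r t where "x = (r, t)" by fastforce
    with integrable_move[OF st ms g, of r t] x show ?thesis by simp
  qed
  have gen: "generator ms g = (\<lambda>s. (\<Sum>x\<leftarrow>ms. case x of (r, t) \<Rightarrow> r s * g (t s)) - exit_rate ms s * g s)" for g
    by (auto simp: generator_eq case_prod_unfold)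
  have int_gen: "integrable p (generator ms g)" if g: "integrable p g" for g
    unfolding gen
    by (intro Bochner_Integration.integrable_diff integrable_sum_list integrable_exit_rate_mult[OF ms g])
       (use int g in auto)
  have zero: "measure_pmf.expectation p (generator ms g) = 0"
    if g: "integrable p g" and nonneg: "\<And>s. 0 \<le> g s" for g
  proof -
    have sl: "integrable p (\<lambda>s. \<Sum>x\<leftarrow>ms. case x of (r, t) \<Rightarrow> r s * g (t s))"
      by (rule integrable_sum_list) (use int g in auto)
    have "(\<integral>s. (\<Sum>x\<leftarrow>ms. case x of (r, t) \<Rightarrow> r s * g (t s)) \<partial>p)
        = (\<Sum>(r, t)\<leftarrow>ms. \<integral>s. r s * g (t s) \<partial>p)"
      by (subst integrable_sum_list(2)) (use int g in \<open>auto simp: case_prod_unfold\<close>)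
    then show ?thesis
      unfolding gen using flow_balance_nonneg[OF st ms g nonneg] sl integrable_exit_rate_mult[OF ms g]
      by simp
  qed
  show "integrable p (generator ms f)"
    by (rule int_gen[OF f])
  let ?g = "\<lambda>s. max (f s) 0" and ?h = "\<lambda>s. max (- f s) 0"
  have gh: "integrable p ?g" "integrable p ?h"
    using f by auto
  have "generator ms f = (\<lambda>s. generator ms ?g s - generator ms ?h s)"
  proof
    fix s
    have "r * (f x - f y) = r * (?g x - ?g y) - r * (?h x - ?h y)" for r x y
      by (auto simp: algebra_simps max_def)
    then show "generator ms f s = generator ms ?g s - generator ms ?h s"
      by (induction ms) (auto simp: generator_def)
  qed
  then show "measure_pmf.expectation p (generator ms f) = 0"
    using int_gen[OF gh(1)] int_gen[OF gh(2)] zero[OF gh(1)] zero[OF gh(2)] by simp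
qed

section \<open>Uniqueness, compactness and moments of stationary laws\<close>

definition steps :: "'s move list \<Rightarrow> ('s \<times> 's) set" where
  "steps ms = {(s, t s) | r t s. (r, t) \<in> set ms \<and> 0 < r s}"

lemma expectation_eq_count_space:
  "measure_pmf.expectation p g = (\<integral>s. pmf p s * g s \<partial>count_space UNIV)" for g :: "'s \<Rightarrow> real"
  unfolding measure_pmf_eq_density by (subst integral_density) auto

lemma generator_unit_bound:
  assumes "bounded_moves ms" and f: "\<And>s. 0 \<le> f s \<and> f s \<le> 1"
  shows "\<bar>generator ms f s\<bar> \<le> exit_rate ms s"
  using assms(1)
proof (induction ms)
  case (Cons m ms)
  obtain r t where m: "m = (r, t)" by (cases m)
  have r: "0 \<le> r s" using Cons.prems by (auto simp: m bounded_moves_def)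
  have "\<bar>f (t s) - f s\<bar> \<le> 1" using f[of s] f[of "t s"] by linarith
  with r have "\<bar>r s * (f (t s) - f s)\<bar> \<le> r s"
    by (simp add: abs_mult mult_left_le)
  moreover have "\<bar>generator ms f s\<bar> \<le> exit_rate ms s"
    using Cons by (auto simp: bounded_moves_def)
  ultimately show ?case
    by (simp add: generator_def exit_rate_def m)
qed (simp add: generator_def exit_rate_def)

lemma generator_indicator_bound:
  "bounded_moves ms \<Longrightarrow> \<bar>generator ms (indicator A) s\<bar> \<le> exit_rate ms s"
  by (rule generator_unit_bound) auto

lemma integrable_mult_generator:
  fixes u :: "'s \<Rightarrow> real"
  assumes ms: "bounded_moves ms" and u: "integrable (count_space UNIV) u"
  shows "integrable (count_space UNIV) (\<lambda>s. u s * generator ms (indicator A) s)"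
proof -
  obtain B where B: "exit_rate ms s \<le> B" for s
    using exit_rate_bounded[OF ms] by blast
  have bound: "\<bar>generator ms (indicator A) s\<bar> \<le> \<bar>B\<bar>" for s
    using generator_indicator_bound[OF ms, of A s] B[of s] by simp
  show ?thesis
  proof (rule Bochner_Integration.integrable_bound)
    show "integrable (count_space UNIV) (\<lambda>s. u s * B)"
      using u by simp
    show "AE s in count_space UNIV. norm (u s * generator ms (indicator A) s) \<le> norm (u s * B)"
      using bound by (auto simp: abs_mult intro!: mult_left_mono)
  qed simp
qed

text \<open>
  Test the invariant signed weight \<open>u\<close> with the indicator of \<open>{u > 0}\<close>. On this set the
  generator of the indicator is \<open>\<le> 0\<close>, off the set it is \<open>\<ge> 0\<close>; hence every term
  of the integral is \<open>\<le> 0\<close>. As they sum to \<open>0\<close>, each of them vanishes, so no step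
  leaves \<open>{u > 0}\<close>.
\<close>

lemma positive_set_closed:
  fixes u :: "'s \<Rightarrow> real"
  assumes ms: "bounded_moves ms" and u: "integrable (count_space UNIV) u"
    and zero: "(\<integral>s. u s * generator ms (indicator {s. 0 < u s}) s \<partial>count_space UNIV) = 0"
    and s: "0 < u s" and step: "(s, s') \<in> steps ms"
  shows "0 < u s'"
proof -
  let ?A = "{s. 0 < u s}"
  have r: "0 \<le> r s" if "(r, t) \<in> set ms" for r t s
    using that ms by (auto simp: bounded_moves_def)
  have out: "0 \<le> - generator ms (indicator ?A) s" if "0 < u s" for s
    unfolding generator_def uminus_sum_list_map o_def
    using that r by (auto intro!: sum_list_nonneg mult_nonneg_nonpos simp: indicator_def)
  have "0 \<le> generator ms (indicator ?A) s" if "\<not> 0 < u s" for s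
    unfolding generator_def using that r by (fastforce intro!: sum_list_nonneg simp: indicator_def)
  with out have nonneg: "0 \<le> - (u s * generator ms (indicator ?A) s)" for s
    by (cases "0 < u s") (auto simp: mult_le_0_iff zero_le_mult_iff not_less)
  have "AE s in count_space UNIV. - (u s * generator ms (indicator ?A) s) = 0"
    using integrable_mult_generator[OF ms u] zero nonneg
    by (subst integral_nonneg_eq_0_iff_AE[symmetric]) auto
  then have "u s * generator ms (indicator ?A) s = 0"
    by (simp add: AE_count_space)
  with s have *: "(\<Sum>(r, t)\<leftarrow>ms. r s * (1 - indicator ?A (t s))) = 0"
  proof -
    have "(\<Sum>(r, t)\<leftarrow>ms. r s * (1 - indicator ?A (t s))) = - generator ms (indicator ?A) s"
      unfolding generator_def using s by (induction ms) (auto simp: algebra_simps)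
    then show ?thesis using \<open>u s * generator ms (indicator ?A) s = 0\<close> s by simp
  qed
  obtain r t where rt: "(r, t) \<in> set ms" "0 < r s" "s' = t s"
    using step by (auto simp: steps_def)
  have "r s * (1 - indicator ?A (t s)) \<le> (\<Sum>(r, t)\<leftarrow>ms. r s * (1 - indicator ?A (t s)))"
    using rt(1) r by (intro member_le_sum_list)
      (force simp: image_iff indicator_def intro!: bexI[of _ "(r, t)"])+
  with * rt(2) have "indicator ?A (t s) = (1 :: real)"
    by (cases "0 < u (t s)") (auto simp: indicator_def mult_le_0_iff)
  then show ?thesis
    by (cases "0 < u (t s)") (auto simp: rt(3))
qed

text \<open>
  Both \<open>{u > 0}\<close> and \<open>{u < 0}\<close> are closed under steps and would contain the state
  \<open>b\<close>, to which every state leads. So one of them is empty; then \<open>u\<close> has a constant sign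
  and total mass \<open>0\<close>. Applied to a difference of two stationary weights this is uniqueness of the
  stationary law.
\<close>

lemma signed_invariant_zero:
  fixes u :: "'s \<Rightarrow> real"
  assumes ms: "bounded_moves ms" and u: "integrable (count_space UNIV) u"
    and total: "(\<integral>s. u s \<partial>count_space UNIV) = 0"
    and zero: "\<And>A. (\<integral>s. u s * generator ms (indicator A) s \<partial>count_space UNIV) = 0"
    and reach: "\<And>s. (s, b) \<in> (steps ms)\<^sup>*"
  shows "u s = 0"
proof -
  have pos: "0 < v b"
    if v: "integrable (count_space UNIV) v"
      "(\<integral>s. v s * generator ms (indicator {s. 0 < v s}) s \<partial>count_space UNIV) = 0" "0 < v s"
    for v :: "'s \<Rightarrow> real" and s
    using reach[of s] v(3)
    by (induction rule: converse_rtrancl_induct) (use positive_set_closed[OF ms v(1,2)] in auto)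
  have "\<not> 0 < u s" if "u b \<le> 0" for s
    using pos[of u s, OF u zero] that by auto
  moreover have "\<not> 0 < - u s" if "0 \<le> u b" for s
    using pos[of "\<lambda>s. - u s" s] that u zero by auto
  ultimately have "(\<forall>s. 0 \<le> u s) \<or> (\<forall>s. 0 \<le> - u s)"
    by (cases "u b \<le> 0") (auto simp: not_less)
  then show ?thesis
  proof
    assume "\<forall>s. 0 \<le> u s"
    then have "AE s in count_space UNIV. u s = 0"
      using u total by (subst integral_nonneg_eq_0_iff_AE[symmetric]) auto
    then show ?thesis by (simp add: AE_count_space)
  next
    assume "\<forall>s. 0 \<le> - u s"
    then have "AE s in count_space UNIV. - u s = 0"
      using u total by (subst integral_nonneg_eq_0_iff_AE[symmetric]) auto
    then show ?thesis by (simp add: AE_count_space)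
  qed
qed

text \<open>
  Compactness turns uniqueness into convergence. Along a subsequence the weights converge pointwise; the summable
  majorant \<open>D\<close> prevents loss of mass and lets the equations pass to the limit, which is then
  stationary and so equals \<open>V\<close>.
\<close>

theorem asymptotically_stationary_converges:
  fixes P :: "nat \<Rightarrow> 's pmf" and V :: "'s pmf"
  assumes cnt: "countable (UNIV :: 's set)" and ms: "bounded_moves ms"
    and D: "integrable (count_space UNIV) D" and PD: "\<And>j s. pmf (P j) s \<le> D s"
    and PA: "\<And>A. (\<lambda>j. measure_pmf.expectation (P j) (generator ms (indicator A))) \<longlonglongrightarrow> 0"
    and VA: "\<And>A. measure_pmf.expectation V (generator ms (indicator A)) = 0"
    and reach: "\<And>s. (s, b) \<in> (steps ms)\<^sup>*"
  shows "(\<lambda>j. measure_pmf.prob (P j) A) \<longlonglongrightarrow> measure_pmf.prob V A"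
proof (rule ccontr)
  assume "\<not> ?thesis"
  then obtain e where e: "e > 0"
    and freq: "\<not> (\<forall>\<^sub>F j in sequentially. dist (measure_pmf.prob (P j) A) (measure_pmf.prob V A) < e)"
    by (auto simp: tendsto_iff)
  let ?S = "{j. e \<le> dist (measure_pmf.prob (P j) A) (measure_pmf.prob V A)}"
  have "infinite ?S"
    using freq by (simp add: cofinite_eq_sequentially[symmetric] eventually_cofinite not_less)
  then obtain f :: "nat \<Rightarrow> nat" where f: "strict_mono f" "\<And>n. f n \<in> ?S"
    using infinite_enumerate by blast
  obtain k where k: "strict_mono (k :: nat \<Rightarrow> nat)"
    and conv: "\<And>s. s \<in> UNIV \<Longrightarrow> \<exists>l. (\<lambda>n. pmf (P (f (k n))) s) \<longlonglongrightarrow> l"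
    by (rule function_convergent_subsequence[OF cnt, of "\<lambda>n s. pmf (P (f n)) s" 1])
       (auto simp: pmf_le_1)
  define q where "q s = lim (\<lambda>n. pmf (P (f (k n))) s)" for s
  have q: "(\<lambda>n. pmf (P (f (k n))) s) \<longlonglongrightarrow> q s" for s
    using conv[of s] unfolding q_def by (simp add: convergent_def[symmetric] convergent_LIMSEQ_iff)
  have fk: "strict_mono (\<lambda>n. f (k n))"
    using f(1) k by (auto simp: strict_mono_def)
  have lim: "(\<lambda>n. measure_pmf.expectation (P (f (k n))) g) \<longlonglongrightarrow> (\<integral>s. q s * g s \<partial>count_space UNIV)"
    if g: "\<And>s. \<bar>g s\<bar> \<le> B" for g B
    unfolding expectation_eq_count_space
  proof (rule integral_dominated_convergence[where w = "\<lambda>s. D s * B"])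
    show "integrable (count_space UNIV) (\<lambda>s. D s * B)" using D by simp
    show "AE s in count_space UNIV. (\<lambda>n. pmf (P (f (k n))) s * g s) \<longlonglongrightarrow> q s * g s"
      using q by (auto intro!: tendsto_intros)
    show "AE s in count_space UNIV. norm (pmf (P (f (k n))) s * g s) \<le> D s * B" for n
      using PD g by (auto simp: abs_mult intro!: mult_mono order_trans[OF pmf_nonneg PD])
  qed auto
  have q_int: "integrable (count_space UNIV) q"
  proof (rule Bochner_Integration.integrable_bound[OF D])
    have "0 \<le> q s \<and> q s \<le> D s" for s
      using LIMSEQ_le_const[OF q, of 0 s] LIMSEQ_le_const2[OF q, of s "D s"] PD by auto
    then show "AE s in count_space UNIV. norm (q s) \<le> norm (D s)"
      by (auto intro!: AE_I2 order_trans[OF _ abs_ge_self])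
  qed simp
  have V_int: "integrable (count_space UNIV) (pmf V)"
    by (rule integrable_pmf)
  obtain B where B: "exit_rate ms s \<le> B" for s
    using exit_rate_bounded[OF ms] by blast
  have gen_bound: "\<bar>generator ms (indicator A) s\<bar> \<le> B" for A s
    using generator_indicator_bound[OF ms, of A s] B[of s] by simp
  have "q s - pmf V s = 0" for s
  proof (rule signed_invariant_zero[OF ms _ _ _ reach])
    show "integrable (count_space UNIV) (\<lambda>s. q s - pmf V s)"
      using q_int V_int by simp
    have "(\<integral>s. q s * 1 \<partial>count_space UNIV) = 1"
      using lim[of "\<lambda>_. 1" 1] by (simp add: LIMSEQ_const_iff)
    then show "(\<integral>s. q s - pmf V s \<partial>count_space UNIV) = 0"
      using q_int V_int integral_pmf[where M = V and X = UNIV] by simp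
    show "(\<integral>s. (q s - pmf V s) * generator ms (indicator A) s \<partial>count_space UNIV) = 0" for A
    proof -
      have "(\<integral>s. q s * generator ms (indicator A) s \<partial>count_space UNIV) = 0"
        using LIMSEQ_unique[OF lim[OF gen_bound[of A]] LIMSEQ_subseq_LIMSEQ[OF PA[of A] fk, unfolded o_def]] .
      then show ?thesis
        using VA[of A] integrable_mult_generator[OF ms q_int, of A] integrable_mult_generator[OF ms V_int, of A]
        by (simp add: expectation_eq_count_space left_diff_distrib)
    qed
  qed
  then have "(\<lambda>n. measure_pmf.prob (P (f (k n))) A) \<longlonglongrightarrow> measure_pmf.prob V A"
    using lim[of "indicator A" 1] by (simp add: expectation_eq_count_space[symmetric] indicator_abs_le_1)
  then have "\<forall>\<^sub>F n in sequentially. dist (measure_pmf.prob (P (f (k n))) A) (measure_pmf.prob V A) < e"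
    using e by (auto simp: tendsto_iff)
  then obtain n where "dist (measure_pmf.prob (P (f (k n))) A) (measure_pmf.prob V A) < e"
    by (auto simp: eventually_sequentially)
  with f(2)[of "k n"] show False by simp
qed

text \<open>
  A Foster--Lyapunov bound. Since \<open>f\<close> is not yet known to be integrable, the generator is applied to
  \<open>min f K\<close>: below the level \<open>K\<close> truncation only lowers the targets, and above it the
  generator is \<open>\<le> 0\<close>. This bounds the expectation of \<open>f\<close> over \<open>{f < K}\<close>
  by \<open>C / c\<close> for every \<open>K\<close>.
\<close>

theorem drift_moment_bound:
  fixes p :: "'s pmf"
  assumes st: "stationary (jump_rate ms) p" and ms: "bounded_moves ms"
    and f: "\<And>s. 0 \<le> f s" and c: "0 < c" and C: "0 \<le> C"
    and drift: "\<And>s. s \<in> set_pmf p \<Longrightarrow> generator ms f s \<le> C - c * f s"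
  shows "integrable p f" and "measure_pmf.expectation p f \<le> C / c"
proof -
  have r: "0 \<le> r s" if "(r, t) \<in> set ms" for r t s
    using that ms by (auto simp: bounded_moves_def)
  have trunc: "measure_pmf.expectation p (\<lambda>s. f s * indicator {s. f s < K} s) \<le> C / c"
    if K: "0 < K" for K
  proof -
    let ?f = "\<lambda>s. min (f s) K"
    let ?g = "\<lambda>s. f s * indicator {s. f s < K} s"
    have int: "integrable p ?f" "integrable p ?g"
      by (rule measure_pmf.integrable_const_bound[where B = K]; use f K in \<open>auto simp: indicator_def\<close>)+
    have "generator ms ?f s \<le> C - c * ?g s" if s: "s \<in> set_pmf p" for s
    proof (cases "f s < K")
      case True
      have "generator ms ?f s \<le> generator ms f s"
        unfolding generator_def using True r
        by (intro sum_list_mono) (auto intro!: mult_left_mono)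
      with drift[OF s] True show ?thesis by simp
    next
      case False
      have "0 \<le> - generator ms ?f s"
        unfolding generator_def uminus_sum_list_map o_def
        using False r by (auto intro!: sum_list_nonneg mult_nonneg_nonpos)
      with C False show ?thesis by simp
    qed
    then have "measure_pmf.expectation p (generator ms ?f) \<le> measure_pmf.expectation p (\<lambda>s. C - c * ?g s)"
      using int stationary_generator(1)[OF st ms int(1)]
      by (intro integral_mono_AE) (auto simp: AE_measure_pmf_iff)
    then have "c * measure_pmf.expectation p ?g \<le> C"
      using stationary_generator(2)[OF st ms int(1)] int(2) by simp
    with c show ?thesis by (simp add: field_simps)
  qed
  have "(\<integral>\<^sup>+ s. ennreal (f s) \<partial>p) = (\<integral>\<^sup>+ s. (SUP n. ennreal (f s * indicator {s. f s < real (Suc n)} s)) \<partial>p)"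
  proof (rule nn_integral_cong)
    fix s
    obtain n where "f s < real n" using reals_Archimedean2 by blast
    then have "ennreal (f s) \<le> ennreal (f s * indicator {s. f s < real (Suc n)} s)" by simp
    also have "\<dots> \<le> (SUP n. ennreal (f s * indicator {s. f s < real (Suc n)} s))" by (rule SUP_upper) simp
    finally show "ennreal (f s) = (SUP n. ennreal (f s * indicator {s. f s < real (Suc n)} s))"
      using f by (intro antisym SUP_least) (auto intro!: ennreal_leI simp: indicator_def)
  qed
  also have "\<dots> = (SUP n. \<integral>\<^sup>+ s. ennreal (f s * indicator {s. f s < real (Suc n)} s) \<partial>p)"
    by (rule nn_integral_monotone_convergence_SUP)
       (use f in \<open>auto intro!: monoI le_funI ennreal_leI simp: indicator_def\<close>)
  also have "\<dots> \<le> ennreal (C / c)"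
  proof (rule SUP_least)
    fix n
    have "integrable p (\<lambda>s. f s * indicator {s. f s < real (Suc n)} s)"
      by (rule measure_pmf.integrable_const_bound[where B = "real (Suc n)"])
         (use f in \<open>auto simp: indicator_def\<close>)
    then have "(\<integral>\<^sup>+ s. ennreal (f s * indicator {s. f s < real (Suc n)} s) \<partial>p)
        = ennreal (measure_pmf.expectation p (\<lambda>s. f s * indicator {s. f s < real (Suc n)} s))"
      using f by (intro nn_integral_eq_integral) auto
    also have "\<dots> \<le> ennreal (C / c)"
      by (intro ennreal_leI trunc) simp
    finally show "(\<integral>\<^sup>+ s. ennreal (f s * indicator {s. f s < real (Suc n)} s) \<partial>p) \<le> ennreal (C / c)" .
  qed
  finally have *: "(\<integral>\<^sup>+ s. ennreal (f s) \<partial>p) \<le> ennreal (C / c)" .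
  then have "(\<integral>\<^sup>+ s. ennreal (f s) \<partial>p) < \<infinity>"
    by (rule order.strict_trans1) simp
  with f show "integrable p f"
    by (intro integrableI_nonneg) auto
  with * f show "measure_pmf.expectation p f \<le> C / c"
    using C c by (subst (asm) nn_integral_eq_integral) (auto simp: ennreal_le_iff)
qed

section \<open>Convergence to the exponential law from its Laplace transform\<close>

lemma exponential_laplace:
  assumes "0 < \<eta>"
  shows "(\<integral>t. exp (- t) ^ k \<partial>density lborel (exponential_density \<eta>)) = \<eta> / (\<eta> + real k)"
    and "integrable (density lborel (exponential_density \<eta>)) (\<lambda>t. exp (- t) ^ k)"
proof -
  let ?E = "\<lambda>l. density lborel (exponential_density l)"
  have pos: "0 < \<eta> + real k" using assms by simp
  interpret prob_space "?E (\<eta> + real k)"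
    by (rule prob_space_exponential_density[OF pos])
  have eq: "exponential_density \<eta> t * exp (- t) ^ k
      = \<eta> / (\<eta> + real k) * exponential_density (\<eta> + real k) t" for t
    using pos by (simp add: exponential_density_def exp_of_nat_mult[symmetric] exp_add[symmetric] field_simps)
  have "integrable (?E (\<eta> + real k)) (\<lambda>t. 1 :: real)" by simp
  then have int: "integrable lborel (exponential_density (\<eta> + real k))"
    using pos by (subst (asm) integrable_density) (auto simp: exponential_density_nonneg)
  have "(\<integral>t. 1 \<partial>?E (\<eta> + real k)) = (1 :: real)"
    using prob_space by simp
  then have one: "(\<integral>t. exponential_density (\<eta> + real k) t \<partial>lborel) = 1"
    using pos by (subst (asm) integral_density) (auto simp: exponential_density_nonneg)
  show "(\<integral>t. exp (- t) ^ k \<partial>?E \<eta>) = \<eta> / (\<eta> + real k)"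
    using assms by (subst integral_density) (auto simp: exponential_density_nonneg eq one)
  show "integrable (?E \<eta>) (\<lambda>t. exp (- t) ^ k)"
    using assms int by (subst integrable_density) (auto simp: exponential_density_nonneg eq)
qed

lemma exponential_measure_atMost:
  assumes "0 < \<eta>" "0 \<le> a"
  shows "measure (density lborel (exponential_density \<eta>)) {..a} = 1 - exp (- \<eta> * a)"
  using emeasure_erlang_density[OF assms(1), of 0 a] assms
  by (simp add: measure_def erlang_CDF_def)

text \<open>
  The assumption is the convergence of all moments of \<open>exp (- T)\<close>, a variable with values in
  \<open>[0, 1]\<close>, on the event \<open>A\<close>. Polynomials are uniformly dense in the continuous
  functions on \<open>[0, 1]\<close>.
\<close>

lemma exponential_tendsto_continuous:
  fixes P :: "'e \<Rightarrow> 's pmf" and T :: "'e \<Rightarrow> 's \<Rightarrow> real"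
  assumes \<eta>: "0 < \<eta>" and c: "0 \<le> c" and T: "\<And>\<epsilon> s. 0 \<le> T \<epsilon> s"
    and moments: "\<And>k. ((\<lambda>\<epsilon>. measure_pmf.expectation (P \<epsilon>) (\<lambda>s. indicator A s * exp (- T \<epsilon> s) ^ k))
        \<longlongrightarrow> c * (\<eta> / (\<eta> + real k))) F"
    and h: "continuous_on UNIV h"
  shows "((\<lambda>\<epsilon>. measure_pmf.expectation (P \<epsilon>) (\<lambda>s. indicator A s * h (exp (- T \<epsilon> s))))
        \<longlongrightarrow> c * (\<integral>t. h (exp (- t)) \<partial>density lborel (exponential_density \<eta>))) F"
proof (rule tendstoI)
  let ?M = "density lborel (exponential_density \<eta>)"
  interpret M: prob_space ?M
    by (rule prob_space_exponential_density[OF \<eta>])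
  have M_pos: "AE t in ?M. 0 \<le> t"
    by (subst AE_density) (auto simp: exponential_density_def)
  fix e :: real
  assume e: "0 < e"
  define d where "d = e / (2 + c)"
  have d: "0 < d" using e c by (simp add: d_def)
  \<comment> \<open>The approximation error \<open>d\<close> enters three times, once with the factor \<open>c\<close>, whence \<open>e = (2 + c) * d\<close>.\<close>
  obtain g where g: "real_polynomial_function g" and hg: "\<And>y. y \<in> {0..1} \<Longrightarrow> \<bar>h y - g y\<bar> < d"
    using Stone_Weierstrass_real_polynomial_function[of "{0..1}" h d] d
      continuous_on_subset[OF h] by (metis compact_Icc top_greatest)
  obtain a n where ga: "g = (\<lambda>y. \<Sum>i\<le>(n :: nat). a i * y ^ i)"
    using g real_polynomial_function_iff_sum by blast
  have g_cont: "continuous_on UNIV g"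
    unfolding ga by (intro continuous_intros)
  have bdd: "\<exists>B. \<forall>y \<in> {0..1}. \<bar>f y\<bar> \<le> B" if "continuous_on UNIV f" for f :: "real \<Rightarrow> real"
  proof -
    have "bounded (f ` {0..1})"
      using that by (intro compact_imp_bounded compact_continuous_image) (auto intro: continuous_on_subset)
    then show ?thesis by (auto simp: bounded_iff)
  qed
  have y01: "exp (- T \<epsilon> s) \<in> {0..1}" for \<epsilon> s
    using T by simp
  have intP: "integrable (P \<epsilon>) (\<lambda>s. indicator A s * f (exp (- T \<epsilon> s)))"
    if f: "continuous_on UNIV f" for f :: "real \<Rightarrow> real" and \<epsilon>
  proof -
    obtain B where B: "\<forall>y \<in> {0..1}. \<bar>f y\<bar> \<le> B" using bdd[OF f] by blast
    have "\<bar>f (exp (- T \<epsilon> s))\<bar> \<le> B" for s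
      using B y01 by blast
    then have "\<bar>indicator A s * f (exp (- T \<epsilon> s))\<bar> \<le> \<bar>B\<bar>" for s
      by (auto simp: indicator_def intro: order_trans[OF _ abs_ge_self])
    then show ?thesis
      by (intro measure_pmf.integrable_const_bound[where B = "\<bar>B\<bar>"]) auto
  qed
  have intM: "integrable ?M (\<lambda>t. f (exp (- t)))" if f: "continuous_on UNIV f" for f :: "real \<Rightarrow> real"
  proof -
    obtain B where B: "\<forall>y \<in> {0..1}. \<bar>f y\<bar> \<le> B" using bdd[OF f] by blast
    have [measurable]: "f \<in> borel_measurable borel"
      using f by (rule borel_measurable_continuous_onI)
    show ?thesis
      by (rule M.integrable_const_bound[where B = B]) (use M_pos B in auto)
  qed
  have Mg: "(\<integral>t. g (exp (- t)) \<partial>?M) = (\<Sum>i\<le>n. a i * (\<eta> / (\<eta> + real i)))"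
    unfolding ga by (subst Bochner_Integration.integral_sum)
      (auto simp: exponential_laplace[OF \<eta>])
  have Pg: "measure_pmf.expectation (P \<epsilon>) (\<lambda>s. indicator A s * g (exp (- T \<epsilon> s)))
     = (\<Sum>i\<le>n. a i * measure_pmf.expectation (P \<epsilon>) (\<lambda>s. indicator A s * exp (- T \<epsilon> s) ^ i))" for \<epsilon>
  proof -
    have "integrable (P \<epsilon>) (\<lambda>s. a i * (indicator A s * exp (- T \<epsilon> s) ^ i))" for i
      using intP[of "\<lambda>y. y ^ i" \<epsilon>] by (simp add: continuous_intros)
    then show ?thesis
      by (simp add: ga sum_distrib_left mult.left_commute[of "indicator A _"])
  qed
  have "((\<lambda>\<epsilon>. measure_pmf.expectation (P \<epsilon>) (\<lambda>s. indicator A s * g (exp (- T \<epsilon> s))))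
        \<longlongrightarrow> (\<Sum>i\<le>n. a i * (c * (\<eta> / (\<eta> + real i))))) F"
    unfolding Pg by (intro tendsto_intros moments)
  then have "((\<lambda>\<epsilon>. measure_pmf.expectation (P \<epsilon>) (\<lambda>s. indicator A s * g (exp (- T \<epsilon> s))))
        \<longlongrightarrow> c * (\<integral>t. g (exp (- t)) \<partial>?M)) F"
    by (simp add: Mg sum_distrib_left mult.left_commute)
  then have "\<forall>\<^sub>F \<epsilon> in F. dist (measure_pmf.expectation (P \<epsilon>) (\<lambda>s. indicator A s * g (exp (- T \<epsilon> s))))
      (c * (\<integral>t. g (exp (- t)) \<partial>?M)) < d"
    using d by (rule tendstoD)
  then show "\<forall>\<^sub>F \<epsilon> in F. dist (measure_pmf.expectation (P \<epsilon>) (\<lambda>s. indicator A s * h (exp (- T \<epsilon> s))))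
      (c * (\<integral>t. h (exp (- t)) \<partial>?M)) < e"
  proof eventually_elim
    case (elim \<epsilon>)
    let ?Eh = "measure_pmf.expectation (P \<epsilon>) (\<lambda>s. indicator A s * h (exp (- T \<epsilon> s)))"
    let ?Eg = "measure_pmf.expectation (P \<epsilon>) (\<lambda>s. indicator A s * g (exp (- T \<epsilon> s)))"
    have "?Eh - ?Eg = measure_pmf.expectation (P \<epsilon>)
        (\<lambda>s. indicator A s * h (exp (- T \<epsilon> s)) - indicator A s * g (exp (- T \<epsilon> s)))"
      using intP[OF h] intP[OF g_cont] by simp
    also have "\<bar>\<dots>\<bar> \<le> measure_pmf.expectation (P \<epsilon>)
        (\<lambda>s. \<bar>indicator A s * h (exp (- T \<epsilon> s)) - indicator A s * g (exp (- T \<epsilon> s))\<bar>)"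
      by (rule integral_abs_bound)
    also have "\<dots> \<le> measure_pmf.expectation (P \<epsilon>) (\<lambda>s. d)"
      using intP[OF h] intP[OF g_cont] less_imp_le[OF hg[OF y01]] d
      by (intro integral_mono) (auto simp: indicator_def)
    finally have 1: "\<bar>?Eh - ?Eg\<bar> \<le> d" by simp
    let ?Mh = "\<integral>t. h (exp (- t)) \<partial>?M" and ?Mg = "\<integral>t. g (exp (- t)) \<partial>?M"
    have "?Mh - ?Mg = (\<integral>t. h (exp (- t)) - g (exp (- t)) \<partial>?M)"
      using intM[OF h] intM[OF g_cont] by simp
    also have "\<bar>\<dots>\<bar> \<le> (\<integral>t. \<bar>h (exp (- t)) - g (exp (- t))\<bar> \<partial>?M)"
      by (rule integral_abs_bound)
    also have "\<dots> \<le> (\<integral>t. d \<partial>?M)"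
      using intM[OF h] intM[OF g_cont] M_pos
      by (intro integral_mono_AE) (auto intro!: less_imp_le[OF hg])
    finally have "\<bar>?Mh - ?Mg\<bar> \<le> d" using M.prob_space by simp
    then have 2: "\<bar>c * ?Mh - c * ?Mg\<bar> \<le> c * d"
      using c by (simp add: abs_mult right_diff_distrib[symmetric] mult_left_mono)
    have "e = (2 + c) * d"
      using c by (simp add: d_def)
    with 1 2 elim show ?case
      by (simp add: dist_real_def algebra_simps)
  qed
qed

definition ramp :: "real \<Rightarrow> real \<Rightarrow> real \<Rightarrow> real" where
  "ramp a b y = max 0 (min 1 ((y - a) / (b - a)))"

lemma ramp_props:
  assumes "a < b"
  shows "0 \<le> ramp a b y" "ramp a b y \<le> 1" "y \<le> a \<Longrightarrow> ramp a b y = 0" "b \<le> y \<Longrightarrow> ramp a b y = 1"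
    "continuous_on UNIV (ramp a b)"
proof -
  show "y \<le> a \<Longrightarrow> ramp a b y = 0"
    using assms divide_nonpos_pos[of "y - a" "b - a"] by (simp add: ramp_def)
  show "b \<le> y \<Longrightarrow> ramp a b y = 1"
    using assms by (simp add: ramp_def max_def min_def field_simps)
  show "continuous_on UNIV (ramp a b)"
    unfolding ramp_def using assms by (intro continuous_intros) auto
qed (auto simp: ramp_def)

text \<open>
  The indicator of \<open>{T \<le> \<zeta>}\<close> is enclosed between continuous ramps in
  \<open>exp (- T)\<close> whose other corner lies at \<open>z < \<zeta>\<close> or \<open>z > \<zeta>\<close>;
  the limit distribution function is continuous, so both bounds close up as \<open>z\<close> tends to
  \<open>\<zeta>\<close>.
\<close>

theorem exponential_cdf_of_moments:
  fixes P :: "'e \<Rightarrow> 's pmf" and T :: "'e \<Rightarrow> 's \<Rightarrow> real"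
  assumes \<eta>: "0 < \<eta>" and c: "0 \<le> c" and T: "\<And>\<epsilon> s. 0 \<le> T \<epsilon> s"
    and moments: "\<And>k. ((\<lambda>\<epsilon>. measure_pmf.expectation (P \<epsilon>) (\<lambda>s. indicator A s * exp (- T \<epsilon> s) ^ k))
        \<longlongrightarrow> c * (\<eta> / (\<eta> + real k))) F"
    and \<zeta>: "0 < \<zeta>"
  shows "((\<lambda>\<epsilon>. measure_pmf.prob (P \<epsilon>) {s \<in> A. T \<epsilon> s \<le> \<zeta>}) \<longlongrightarrow> c * (1 - exp (- \<eta> * \<zeta>))) F"
proof -
  let ?M = "density lborel (exponential_density \<eta>)"
  interpret M: prob_space ?M
    by (rule prob_space_exponential_density[OF \<eta>])
  let ?L = "\<lambda>z. c * (1 - exp (- \<eta> * z))"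
  let ?p = "\<lambda>\<epsilon>. measure_pmf.prob (P \<epsilon>) {s \<in> A. T \<epsilon> s \<le> \<zeta>}"
  note lim = exponential_tendsto_continuous[OF \<eta> c T moments]
  have L_cont: "isCont ?L z" for z
    by (intro continuous_intros)
  have p_eq: "?p \<epsilon> = measure_pmf.expectation (P \<epsilon>) (\<lambda>s. indicator A s * indicator {s. T \<epsilon> s \<le> \<zeta>} s)" for \<epsilon>
  proof -
    have "?p \<epsilon> = measure_pmf.expectation (P \<epsilon>) (indicator {s \<in> A. T \<epsilon> s \<le> \<zeta>})" by simp
    also have "\<dots> = measure_pmf.expectation (P \<epsilon>) (\<lambda>s. indicator A s * indicator {s. T \<epsilon> s \<le> \<zeta>} s)"
      by (intro Bochner_Integration.integral_cong) (auto simp: indicator_def)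
    finally show ?thesis .
  qed
  have intP: "integrable (P \<epsilon>) (\<lambda>s. indicator A s * f s)" if "\<And>s. 0 \<le> f s \<and> f s \<le> 1" for f :: "'s \<Rightarrow> real" and \<epsilon>
    by (rule measure_pmf.integrable_const_bound[where B = 1]) (use that in \<open>auto simp: indicator_def\<close>)
  have intM: "integrable ?M (\<lambda>t. ramp a b (exp (- t)))" if "a < b" for a b
  proof -
    have [measurable]: "ramp a b \<in> borel_measurable borel"
      using ramp_props(5)[OF that] by (rule borel_measurable_continuous_onI)
    show ?thesis
      by (rule M.integrable_const_bound[where B = 1]) (use ramp_props(1,2)[OF that] in auto)
  qed
  have intI: "integrable ?M (indicator {..z} :: real \<Rightarrow> real)" for z
    by (rule M.integrable_const_bound[where B = 1]) (auto simp: indicator_def)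
  have M_le: "(\<integral>t. indicator {..z} t \<partial>?M) = 1 - exp (- \<eta> * z)" if "0 \<le> z" for z :: real
    using exponential_measure_atMost[OF \<eta> that] by simp
  show ?thesis
  proof (rule order_tendstoI)
    fix l assume "l < ?L \<zeta>"
    then have "\<forall>\<^sub>F z in at_left \<zeta>. l < ?L z"
      using L_cont[of \<zeta>] by (intro order_tendstoD) (auto simp: isCont_def intro: tendsto_within_subset)
    moreover have "\<forall>\<^sub>F z in at_left \<zeta>. 0 < z \<and> z < \<zeta>"
      using \<zeta> eventually_at_left_real[of 0 \<zeta>] by auto
    ultimately obtain z where z: "l < ?L z" "0 < z" "z < \<zeta>"
      by (metis (mono_tags, lifting) eventually_conj eventually_happens trivial_limit_at_left_real)
    define r where "r = ramp (exp (- \<zeta>)) (exp (- z))"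
    note rp = ramp_props[of "exp (- \<zeta>)" "exp (- z)", folded r_def]
    have ab: "exp (- \<zeta>) < exp (- z)" using z by simp
    have "(\<integral>t. indicator {..z} t \<partial>?M) \<le> (\<integral>t. r (exp (- t)) \<partial>?M)"
      using intM[OF ab] rp(1,4)[OF ab]
      by (intro integral_mono intI) (auto simp: r_def[symmetric] indicator_def)
    then have "?L z \<le> c * (\<integral>t. r (exp (- t)) \<partial>?M)"
      using M_le[of z] z c by (intro mult_left_mono) auto
    with z have "\<forall>\<^sub>F \<epsilon> in F. l < measure_pmf.expectation (P \<epsilon>) (\<lambda>s. indicator A s * r (exp (- T \<epsilon> s)))"
      by (intro order_tendstoD(1)[OF lim[OF rp(5)[OF ab]]]) auto
    then show "\<forall>\<^sub>F \<epsilon> in F. l < ?p \<epsilon>"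
    proof eventually_elim
      case (elim \<epsilon>)
      have "r (exp (- T \<epsilon> s)) \<le> indicator {s. T \<epsilon> s \<le> \<zeta>} s" for s
        using rp(2,3)[OF ab] by (auto simp: indicator_def)
      then have "measure_pmf.expectation (P \<epsilon>) (\<lambda>s. indicator A s * r (exp (- T \<epsilon> s))) \<le> ?p \<epsilon>"
        unfolding p_eq using rp(1,2)[OF ab]
        by (intro integral_mono intP mult_left_mono) (auto simp: indicator_def)
      with elim show ?case by linarith
    qed
  next
    fix l assume "?L \<zeta> < l"
    then have "\<forall>\<^sub>F z in at_right \<zeta>. ?L z < l"
      using L_cont[of \<zeta>] by (intro order_tendstoD) (auto simp: isCont_def intro: tendsto_within_subset)
    moreover have "\<forall>\<^sub>F z in at_right \<zeta>. \<zeta> < z"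
      by (simp add: eventually_at_right_less)
    ultimately obtain z where z: "?L z < l" "\<zeta> < z"
      by (metis (mono_tags, lifting) eventually_conj eventually_happens trivial_limit_at_right_real)
    define r where "r = ramp (exp (- z)) (exp (- \<zeta>))"
    note rp = ramp_props[of "exp (- z)" "exp (- \<zeta>)", folded r_def]
    have ab: "exp (- z) < exp (- \<zeta>)" using z by simp
    have "(\<integral>t. r (exp (- t)) \<partial>?M) \<le> (\<integral>t. indicator {..z} t \<partial>?M)"
      using intM[OF ab] rp(2,3)[OF ab]
      by (intro integral_mono intI) (auto simp: r_def[symmetric] indicator_def)
    then have "c * (\<integral>t. r (exp (- t)) \<partial>?M) \<le> ?L z"
      using M_le[of z] z \<zeta> c by (intro mult_left_mono) auto
    with z have "\<forall>\<^sub>F \<epsilon> in F. measure_pmf.expectation (P \<epsilon>) (\<lambda>s. indicator A s * r (exp (- T \<epsilon> s))) < l"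
      by (intro order_tendstoD(2)[OF lim[OF rp(5)[OF ab]]]) auto
    then show "\<forall>\<^sub>F \<epsilon> in F. ?p \<epsilon> < l"
    proof eventually_elim
      case (elim \<epsilon>)
      have "indicator {s. T \<epsilon> s \<le> \<zeta>} s \<le> r (exp (- T \<epsilon> s))" for s
        using rp(1,4)[OF ab] by (auto simp: indicator_def)
      then have "?p \<epsilon> \<le> measure_pmf.expectation (P \<epsilon>) (\<lambda>s. indicator A s * r (exp (- T \<epsilon> s)))"
        unfolding p_eq using rp(1,2)[OF ab]
        by (intro integral_mono intP mult_left_mono) (auto simp: indicator_def)
      with elim show ?case by linarith
    qed
  qed
qed

section \<open>The two chains and the exponential moment of the workload\<close>

definition polling_moves ::
  "nat \<Rightarrow> real \<Rightarrow> real \<Rightarrow> real \<Rightarrow> real \<Rightarrow> real \<Rightarrow> real \<Rightarrow> polling_state move list" where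
  "polling_moves N lam1 lam2 lam3 mu1 mu2 mu3 =
    [(\<lambda>_. lam1, \<lambda>(p, x1, x2, x3). polling_move N p (x1 + 1, x2, x3)),
     (\<lambda>_. lam2, \<lambda>(p, x1, x2, x3). polling_move N p (x1, x2 + 1, x3)),
     (\<lambda>_. lam3, \<lambda>(p, x1, x2, x3). polling_move N p (x1, x2, x3 + 1)),
     (\<lambda>(p, x1, x2, x3). mu1 * of_bool (p = At1 \<and> x1 > 0), \<lambda>(p, x1, x2, x3). polling_move N p (x1 - 1, x2, x3)),
     (\<lambda>(p, x1, x2, x3). mu2 * of_bool (p = At2 \<and> x2 > 0), \<lambda>(p, x1, x2, x3). polling_move N p (x1, x2 - 1, x3)),
     (\<lambda>(p, x1, x2, x3). mu3 * of_bool (p = At3 \<and> x3 > 0), \<lambda>(p, x1, x2, x3). polling_move N p (x1, x2, x3 - 1))]"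

definition vacation_moves ::
  "nat \<Rightarrow> real \<Rightarrow> real \<Rightarrow> real \<Rightarrow> real \<Rightarrow> vacation_state move list" where
  "vacation_moves N lam1 lam2 mu1 mu2 =
    [(\<lambda>_. lam1, \<lambda>(m, h, l). vacation_move N m (h + 1, l)),
     (\<lambda>_. lam2, \<lambda>(m, h, l). vacation_move N m (h, l + 1)),
     (\<lambda>(m, h, l). mu1 * of_bool (m = Working \<and> h > 0), \<lambda>(m, h, l). vacation_move N m (h - 1, l)),
     (\<lambda>(m, h, l). mu2 * of_bool (m = Working \<and> h = 0 \<and> l > 0), \<lambda>(m, h, l). vacation_move N m (h, l - 1))]"

lemma polling_rate_eq:
  "polling_rate N lam1 lam2 lam3 mu1 mu2 mu3 = jump_rate (polling_moves N lam1 lam2 lam3 mu1 mu2 mu3)"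
proof (intro ext)
  fix s s' :: polling_state
  obtain p x1 x2 x3 where s: "s = (p, x1, x2, x3)" by (rule prod_cases4)
  show "polling_rate N lam1 lam2 lam3 mu1 mu2 mu3 s s' = jump_rate (polling_moves N lam1 lam2 lam3 mu1 mu2 mu3) s s'"
    unfolding s polling_rate_def jump_rate_def polling_moves_def
    by (simp only: prod.case list.map sum_list.Cons sum_list.Nil of_bool_conj mult.assoc add.assoc add_0_right)
qed

lemma vacation_rate_eq:
  "vacation_rate N lam1 lam2 mu1 mu2 = jump_rate (vacation_moves N lam1 lam2 mu1 mu2)"
proof (intro ext)
  fix s s' :: vacation_state
  obtain m h l where s: "s = (m, h, l)" by (rule prod_cases3)
  show "vacation_rate N lam1 lam2 mu1 mu2 s s' = jump_rate (vacation_moves N lam1 lam2 mu1 mu2) s s'"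
    unfolding s vacation_rate_def jump_rate_def vacation_moves_def
    by (simp only: prod.case list.map sum_list.Cons sum_list.Nil of_bool_conj mult.assoc add.assoc add_0_right)
qed

text \<open>
  From any state, also one that violates the vacation rule, a high-priority arrival puts the server to work, and
  then services alone empty the system.
\<close>

lemma vacation_reaches_empty:
  assumes "0 < lam1" "0 < mu1" "0 < mu2"
  shows "(s, (Vacation, 0, 0)) \<in> (steps (vacation_moves N lam1 lam2 mu1 mu2))\<^sup>*"
proof -
  let ?R = "steps (vacation_moves N lam1 lam2 mu1 mu2)"
  have step: "(s, t s) \<in> ?R" if "(r, t) \<in> set (vacation_moves N lam1 lam2 mu1 mu2)" "0 < r s" for r t s
    using that unfolding steps_def by blast
  have low: "((Working, 0, Suc l), (Vacation, 0, 0)) \<in> ?R\<^sup>*" for l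
  proof (induction l)
    case 0
    have "((Working, 0, Suc 0), (Vacation, 0, 0)) \<in> ?R"
      using step[OF _ , of "\<lambda>(m, h, l). mu2 * of_bool (m = Working \<and> h = 0 \<and> l > 0)"
          "\<lambda>(m, h, l). vacation_move N m (h, l - 1)" "(Working, 0, Suc 0)"] assms
      by (simp add: vacation_moves_def)
    then show ?case by blast
  next
    case (Suc l)
    have "((Working, 0, Suc (Suc l)), (Working, 0, Suc l)) \<in> ?R"
      using step[OF _ , of "\<lambda>(m, h, l). mu2 * of_bool (m = Working \<and> h = 0 \<and> l > 0)"
          "\<lambda>(m, h, l). vacation_move N m (h, l - 1)" "(Working, 0, Suc (Suc l))"] assms
      by (simp add: vacation_moves_def)
    then show ?case using Suc by (rule converse_rtrancl_into_rtrancl)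
  qed
  have high: "((Working, Suc h, l), (Vacation, 0, 0)) \<in> ?R\<^sup>*" for h l
  proof (induction h)
    case 0
    have "((Working, Suc 0, l), (if l = 0 then Vacation else Working, 0, l)) \<in> ?R"
      using step[OF _ , of "\<lambda>(m, h, l). mu1 * of_bool (m = Working \<and> h > 0)"
          "\<lambda>(m, h, l). vacation_move N m (h - 1, l)" "(Working, Suc 0, l)"] assms
      by (simp add: vacation_moves_def)
    then show ?case
      using low by (cases l) (auto intro: converse_rtrancl_into_rtrancl)
  next
    case (Suc h)
    have "((Working, Suc (Suc h), l), (Working, Suc h, l)) \<in> ?R"
      using step[OF _ , of "\<lambda>(m, h, l). mu1 * of_bool (m = Working \<and> h > 0)"
          "\<lambda>(m, h, l). vacation_move N m (h - 1, l)" "(Working, Suc (Suc h), l)"] assms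
      by (simp add: vacation_moves_def)
    then show ?case using Suc by (rule converse_rtrancl_into_rtrancl)
  qed
  obtain m h l where s: "s = (m, h, l)" by (cases s)
  have "(s, (Working, Suc h, l)) \<in> ?R"
    using step[OF _ , of "\<lambda>_. lam1" "\<lambda>(m, h, l). vacation_move N m (h + 1, l)" s] assms
    by (cases m) (simp_all add: vacation_moves_def s)
  then show ?thesis using high by (rule converse_rtrancl_into_rtrancl)
qed

lemma bounded_vacation_moves:
  assumes "0 \<le> lam1" "0 \<le> lam2" "0 \<le> mu1" "0 \<le> mu2"
  shows "bounded_moves (vacation_moves N lam1 lam2 mu1 mu2)"
proof -
  have "\<exists>B. \<forall>s. c * of_bool (Q s) \<le> B" if "0 \<le> c" for c :: real and Q :: "vacation_state \<Rightarrow> bool"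
    using that by (intro exI[of _ c]) auto
  from this[of mu1 "\<lambda>(m, h, l). m = Working \<and> h > 0"] this[of mu2 "\<lambda>(m, h, l). m = Working \<and> h = 0 \<and> l > 0"]
  show ?thesis
    using assms by (auto simp: bounded_moves_def vacation_moves_def)
qed

lemma bounded_polling_moves:
  assumes "0 \<le> lam1" "0 \<le> lam2" "0 \<le> lam3" "0 \<le> mu1" "0 \<le> mu2" "0 \<le> mu3"
  shows "bounded_moves (polling_moves N lam1 lam2 lam3 mu1 mu2 mu3)"
proof -
  have "\<exists>B. \<forall>s. c * of_bool (Q s) \<le> B" if "0 \<le> c" for c :: real and Q :: "polling_state \<Rightarrow> bool"
    using that by (intro exI[of _ c]) auto
  from this[of mu1 "\<lambda>(p, x1, x2, x3). p = At1 \<and> x1 > 0"] this[of mu2 "\<lambda>(p, x1, x2, x3). p = At2 \<and> x2 > 0"]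
    this[of mu3 "\<lambda>(p, x1, x2, x3). p = At3 \<and> x3 > 0"]
  show ?thesis
    using assms by (auto simp: bounded_moves_def polling_moves_def)
qed

text \<open>
  The states that the discipline can produce. All others have probability \<open>0\<close> under a stationary law
  (\<open>support_consistent\<close>).
\<close>

fun consistent :: "nat \<Rightarrow> polling_state \<Rightarrow> bool" where
  "consistent N (At1, x1, x2, x3) \<longleftrightarrow> 0 < x1 \<or> (x1, x2, x3) = (0, 0, 0)"
| "consistent N (At2, x1, x2, x3) \<longleftrightarrow> x1 = 0 \<and> 0 < x2"
| "consistent N (At3, x1, x2, x3) \<longleftrightarrow> x1 = 0 \<and> x2 < N \<and> 0 < x3"

lemma consistent_polling_move:
  assumes "1 \<le> N"
  shows "consistent N (polling_move N p x)"
  using assms by (cases x; cases p) (auto simp: polling_move_def settle_def)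

text \<open>
  The two left-hand sides are the relative drifts of \<open>exp (\<delta> * W)\<close>, where \<open>W\<close> is
  the expected work in the first two queues, while the server works at the first or at the second queue. They
  vanish at \<open>\<delta> = 0\<close> with derivative \<open>lam1 / mu1 + lam2 / mu2 - 1 < 0\<close>, so both
  are negative for a small \<open>\<delta> > 0\<close>.
\<close>

lemma exponential_drift_rate:
  fixes lam1 lam2 mu1 mu2 :: real
  assumes "0 < mu1" "0 < mu2" "lam1 / mu1 + lam2 / mu2 < 1"
  obtains \<delta> c where "0 < \<delta>" "0 < c"
    "lam1 * (exp (\<delta> / mu1) - 1) + lam2 * (exp (\<delta> / mu2) - 1) + mu1 * (exp (- \<delta> / mu1) - 1) \<le> - c"
    "lam1 * (exp (\<delta> / mu1) - 1) + lam2 * (exp (\<delta> / mu2) - 1) + mu2 * (exp (- \<delta> / mu2) - 1) \<le> - c"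
proof -
  define F where "F \<mu> \<delta> = lam1 * (exp (\<delta> / mu1) - 1) + lam2 * (exp (\<delta> / mu2) - 1) + \<mu> * (exp (- \<delta> / \<mu>) - 1)"
    for \<mu> \<delta>
  have "\<exists>d>0. \<forall>h>0. h < d \<longrightarrow> F \<mu> 0 > F \<mu> (0 + h)" if "0 < \<mu>" for \<mu>
  proof (rule DERIV_neg_dec_right)
    show "(F \<mu> has_real_derivative lam1 / mu1 + lam2 / mu2 - 1) (at 0)"
      unfolding F_def using that assms by (auto intro!: derivative_eq_intros)
    show "lam1 / mu1 + lam2 / mu2 - 1 < 0" using assms by simp
  qed
  moreover have "F \<mu> 0 = 0" for \<mu> by (simp add: F_def)
  ultimately obtain d1 d2 where "0 < d1" "0 < d2"
    and d1: "\<And>h. 0 < h \<Longrightarrow> h < d1 \<Longrightarrow> F mu1 h < 0" and d2: "\<And>h. 0 < h \<Longrightarrow> h < d2 \<Longrightarrow> F mu2 h < 0"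
    using assms(1,2) by (metis add_0)
  define \<delta> where "\<delta> = min d1 d2 / 2"
  have "0 < \<delta>" "\<delta> < d1" "\<delta> < d2"
    using \<open>0 < d1\<close> \<open>0 < d2\<close> by (auto simp: \<delta>_def min_def)
  moreover from this have "0 < - max (F mu1 \<delta>) (F mu2 \<delta>)"
    using d1 d2 by auto
  ultimately show ?thesis
    by (intro that[of \<delta> "- max (F mu1 \<delta>) (F mu2 \<delta>)"]) (auto simp: F_def)
qed

text \<open>
  One stationary polling system. The constants \<open>\<delta>\<close> and \<open>c\<close> depend only on the
  first two queues, so bounds expressed through them are uniform in the heavy traffic parameter.
\<close>

locale polling_system =
  fixes N :: nat and lam1 lam2 lam3 mu1 mu2 mu3 \<delta> c :: real and p :: "polling_state pmf"
  assumes N: "1 \<le> N"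
    and pos: "0 < lam1" "0 < lam2" "0 < lam3" "0 < mu1" "0 < mu2" "0 < mu3"
    and stationary: "stationary (polling_rate N lam1 lam2 lam3 mu1 mu2 mu3) p"
    and \<delta>: "0 < \<delta>" and c: "0 < c"
    and drift1: "lam1 * (exp (\<delta> / mu1) - 1) + lam2 * (exp (\<delta> / mu2) - 1) + mu1 * (exp (- \<delta> / mu1) - 1) \<le> - c"
    and drift2: "lam1 * (exp (\<delta> / mu1) - 1) + lam2 * (exp (\<delta> / mu2) - 1) + mu2 * (exp (- \<delta> / mu2) - 1) \<le> - c"
begin

abbreviation moves where "moves \<equiv> polling_moves N lam1 lam2 lam3 mu1 mu2 mu3"

abbreviation E where "E \<equiv> measure_pmf.expectation p"

lemma bounded: "bounded_moves moves"
  using pos by (intro bounded_polling_moves) auto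

lemma stationary_moves: "stationary (jump_rate moves) p"
  using stationary by (simp add: polling_rate_eq)

lemmas gen_zero = stationary_generator(2)[OF stationary_moves bounded]
lemmas gen_int = stationary_generator(1)[OF stationary_moves bounded]

text \<open>
  No event leads to an inconsistent state. So the generator of the indicator of these states is minus the exit
  rate times the indicator, and the exit rate is at least \<open>lam1 > 0\<close>.
\<close>

lemma support_consistent:
  assumes "s \<in> set_pmf p"
  shows "consistent N s"
proof -
  let ?f = "indicator {s. \<not> consistent N s} :: polling_state \<Rightarrow> real"
  have gen: "generator moves ?f s = - (exit_rate moves s * ?f s)" for s
    by (cases s) (simp add: generator_def exit_rate_def polling_moves_def consistent_polling_move[OF N] algebra_simps)
  have int: "integrable p ?f"
    by (rule measure_pmf.integrable_const_bound[where B = 1]) (auto simp: indicator_def)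
  have exit: "lam1 \<le> exit_rate moves s" for s
    using pos by (cases s) (simp add: exit_rate_def polling_moves_def)
  have int2: "integrable p (\<lambda>s. exit_rate moves s * ?f s)"
    by (rule integrable_exit_rate_mult[OF bounded int])
  have "E (\<lambda>s. exit_rate moves s * ?f s) = 0"
    using gen_zero[OF int] int2 unfolding gen by simp
  then have "AE s in p. exit_rate moves s * ?f s = 0"
    using int2 exit pos exit_rate_nonneg[OF bounded]
    by (subst (asm) integral_nonneg_eq_0_iff_AE) auto
  then have "exit_rate moves s * ?f s = 0"
    using assms by (auto simp: AE_measure_pmf_iff)
  with exit[of s] pos show ?thesis
    by (cases "consistent N s") auto
qed

definition work :: "polling_state \<Rightarrow> real" where
  "work = (\<lambda>(_, x1, x2, x3). real x1 / mu1 + real x2 / mu2)"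

lemma work_nonneg: "0 \<le> work s"
  using pos by (cases s) (simp add: work_def)

definition exp_moment_bound :: real where
  "exp_moment_bound = (lam1 * (exp (\<delta> / mu1) - 1) + lam2 * (exp (\<delta> / mu2) - 1) + c) * exp (\<delta> * (real N / mu2)) / c"

text \<open>
  The drift is \<open>\<le> - c\<close> relative to \<open>exp (\<delta> * work)\<close> while the server is busy
  at the first two queues. Otherwise the system is empty or the server is at the third queue; then the first queue
  is empty and the second is shorter than \<open>N\<close>, so \<open>exp (\<delta> * work)\<close> is bounded.
\<close>

lemma exp_moment:
  "integrable p (\<lambda>s. exp (\<delta> * work s))" "E (\<lambda>s. exp (\<delta> * work s)) \<le> exp_moment_bound"
proof -
  define \<Lambda> where "\<Lambda> = lam1 * (exp (\<delta> / mu1) - 1) + lam2 * (exp (\<delta> / mu2) - 1)"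
  have \<Lambda>: "0 \<le> \<Lambda>"
    using pos \<delta> by (auto simp: \<Lambda>_def)
  have drift: "generator moves (\<lambda>s. exp (\<delta> * work s)) s
      \<le> (\<Lambda> + c) * exp (\<delta> * (real N / mu2)) - c * exp (\<delta> * work s)" if "s \<in> set_pmf p" for s
  proof -
    obtain q x1 x2 x3 where s: "s = (q, x1, x2, x3)" by (cases s)
    let ?e = "exp (\<delta> * work s)"
    have up1: "exp (\<delta> * work (polling_move N q' (Suc x1, x2, y))) = ?e * exp (\<delta> / mu1)" for q' y
      by (simp add: s work_def polling_move_def exp_add[symmetric] add_divide_distrib algebra_simps)
    have up2: "exp (\<delta> * work (polling_move N q' (x1, Suc x2, y))) = ?e * exp (\<delta> / mu2)" for q' y
      by (simp add: s work_def polling_move_def exp_add[symmetric] add_divide_distrib algebra_simps)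
    have down1: "exp (\<delta> * work (polling_move N q' (x1 - Suc 0, x2, y))) = ?e * exp (- \<delta> / mu1)" if "0 < x1" for q' y
      using that by (simp add: s work_def polling_move_def exp_add[symmetric] of_nat_diff diff_divide_distrib algebra_simps)
    have down2: "exp (\<delta> * work (polling_move N q' (x1, x2 - Suc 0, y))) = ?e * exp (- \<delta> / mu2)" if "0 < x2" for q' y
      using that by (simp add: s work_def polling_move_def exp_add[symmetric] of_nat_diff diff_divide_distrib algebra_simps)
    have same: "work (polling_move N q' (x1, x2, y)) = work s" for q' y
      by (simp add: s work_def polling_move_def)
    have "generator moves (\<lambda>s. exp (\<delta> * work s)) s
       = ?e * (\<Lambda> + of_bool (q = At1 \<and> 0 < x1) * (mu1 * (exp (- \<delta> / mu1) - 1))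
           + of_bool (q = At2 \<and> 0 < x2) * (mu2 * (exp (- \<delta> / mu2) - 1)))"
      unfolding generator_def polling_moves_def \<Lambda>_def
      using down1 down2
      by (cases "q = At1 \<and> 0 < x1"; cases "q = At2 \<and> 0 < x2")
         (auto simp add: s up1 up2 same[unfolded s] ring_distribs)
    also have "\<dots> \<le> (\<Lambda> + c) * exp (\<delta> * (real N / mu2)) - c * ?e"
    proof (cases "(q = At1 \<and> 0 < x1) \<or> (q = At2 \<and> 0 < x2)")
      case True
      then have "\<Lambda> + of_bool (q = At1 \<and> 0 < x1) * (mu1 * (exp (- \<delta> / mu1) - 1))
           + of_bool (q = At2 \<and> 0 < x2) * (mu2 * (exp (- \<delta> / mu2) - 1)) \<le> - c"
        using drift1 drift2 by (auto simp: \<Lambda>_def)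
      then have "?e * (\<Lambda> + of_bool (q = At1 \<and> 0 < x1) * (mu1 * (exp (- \<delta> / mu1) - 1))
           + of_bool (q = At2 \<and> 0 < x2) * (mu2 * (exp (- \<delta> / mu2) - 1))) \<le> ?e * (- c)"
        by (intro mult_left_mono) auto
      also have "\<dots> \<le> (\<Lambda> + c) * exp (\<delta> * (real N / mu2)) - c * ?e"
        using \<Lambda> c by simp
      finally show ?thesis .
    next
      case False
      then have "x1 = 0 \<and> x2 \<le> N"
        using support_consistent[OF that] by (cases q) (auto simp: s)
      then have "\<delta> * work s \<le> \<delta> * (real N / mu2)"
        using pos \<delta> by (intro mult_left_mono) (auto simp: s work_def divide_right_mono)
      then have "(\<Lambda> + c) * ?e \<le> (\<Lambda> + c) * exp (\<delta> * (real N / mu2))"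
        using \<Lambda> c by (intro mult_left_mono) auto
      with False show ?thesis by (auto simp: algebra_simps)
    qed
    finally show ?thesis .
  qed
  have "0 \<le> (\<Lambda> + c) * exp (\<delta> * (real N / mu2))"
    using \<Lambda> c by simp
  from drift_moment_bound[OF stationary_moves bounded _ c this drift]
  show "integrable p (\<lambda>s. exp (\<delta> * work s))" "E (\<lambda>s. exp (\<delta> * work s)) \<le> exp_moment_bound"
    by (auto simp: exp_moment_bound_def \<Lambda>_def)
qed

end

section \<open>Exact identities for the generating functions\<close>

text \<open>
  The weights \<open>at1\<close>, \<open>at2\<close>, \<open>at3\<close> and \<open>idle\<close> indicate where
  the server works; on consistent states they sum to \<open>1\<close>. Functions \<open>g\<close> of the first two
  queue lengths are lifted to states by \<open>on12\<close>.
\<close>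

definition at1 :: "polling_state \<Rightarrow> real" where
  "at1 = (\<lambda>(q, x1, x2, x3). of_bool (q = At1 \<and> 0 < x1))"

definition at2 :: "polling_state \<Rightarrow> real" where
  "at2 = (\<lambda>(q, x1, x2, x3). of_bool (q = At2 \<and> 0 < x2))"

definition at3 :: "polling_state \<Rightarrow> real" where
  "at3 = (\<lambda>(q, x1, x2, x3). of_bool (q = At3 \<and> 0 < x3))"

definition idle :: "polling_state \<Rightarrow> real" where
  "idle = (\<lambda>(q, x). of_bool (x = (0, 0, 0)))"

definition len3 :: "polling_state \<Rightarrow> nat" where
  "len3 = (\<lambda>(q, x1, x2, x3). x3)"

definition on12 :: "(nat \<Rightarrow> nat \<Rightarrow> real) \<Rightarrow> polling_state \<Rightarrow> real" where
  "on12 g = (\<lambda>(q, x1, x2, x3). g x1 x2)"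

lemma server_somewhere: "consistent N s \<Longrightarrow> at1 s + at2 s + at3 s + idle s = 1"
  by (cases "(N, s)" rule: consistent.cases) (auto simp: at1_def at2_def at3_def idle_def)

lemma indicators_01:
  "0 \<le> at1 s" "at1 s \<le> 1" "0 \<le> at2 s" "at2 s \<le> 1" "0 \<le> at3 s" "at3 s \<le> 1" "0 \<le> idle s" "idle s \<le> 1"
  by (auto simp: at1_def at2_def at3_def idle_def split: prod.splits)

context polling_system
begin

lemma dominated:
  assumes f: "\<And>s. \<bar>f s\<bar> \<le> K * exp (\<delta> * work s)"
  shows "integrable p f" and "\<bar>E f\<bar> \<le> K * exp_moment_bound"
proof -
  show int: "integrable p f"
  proof (rule Bochner_Integration.integrable_bound)
    show "integrable p (\<lambda>s. K * exp (\<delta> * work s))" using exp_moment(1) by simp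
    show "AE s in p. norm (f s) \<le> norm (K * exp (\<delta> * work s))"
      using f by (auto intro!: AE_I2 order_trans[OF f])
  qed simp
  have "0 \<le> K * exp (\<delta> * work undefined)"
    using f[of undefined] by (rule order_trans[OF abs_ge_zero])
  then have K: "0 \<le> K" by (simp add: zero_le_mult_iff)
  have "\<bar>E f\<bar> \<le> E (\<lambda>s. \<bar>f s\<bar>)" by (rule integral_abs_bound)
  also have "\<dots> \<le> E (\<lambda>s. K * exp (\<delta> * work s))"
    using int exp_moment(1) f by (intro integral_mono) auto
  also have "\<dots> \<le> K * exp_moment_bound"
    using exp_moment K by (simp add: mult_left_mono)
  finally show "\<bar>E f\<bar> \<le> K * exp_moment_bound" .
qed

text \<open>
  The part of the generator that comes from the first two queues.
\<close>

definition drift12 :: "(nat \<Rightarrow> nat \<Rightarrow> real) \<Rightarrow> polling_state \<Rightarrow> real" where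
  "drift12 g = (\<lambda>(q, x1, x2, x3).
       lam1 * (g (Suc x1) x2 - g x1 x2) + lam2 * (g x1 (Suc x2) - g x1 x2)
     + at1 (q, x1, x2, x3) * mu1 * (g (x1 - 1) x2 - g x1 x2)
     + at2 (q, x1, x2, x3) * mu2 * (g x1 (x2 - 1) - g x1 x2))"

lemma generator_on12:
  assumes "0 < z"
  shows "generator moves (\<lambda>s. on12 g s * z ^ len3 s) s
    = drift12 g s * z ^ len3 s + lam3 * (z - 1) * (on12 g s * z ^ len3 s)
      + mu3 * (1 / z - 1) * (at3 s * on12 g s * z ^ len3 s)"
proof -
  obtain q x1 x2 x3 where s: "s = (q, x1, x2, x3)" by (rule prod_cases4)
  have "z ^ (x3 - Suc 0) = z ^ x3 / z" if "0 < x3"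
    using that assms by (cases x3) auto
  then show ?thesis
    by (simp add: generator_def polling_moves_def s drift12_def on12_def len3_def at1_def at2_def at3_def
        polling_move_def algebra_simps)
qed

text \<open>
  The generator is applied to \<open>g (x1, x2) * z ^ x3\<close>. As \<open>g\<close> depends on queue lengths
  only, the position of the server after the event is irrelevant, and the third queue contributes the factors
  \<open>z - 1\<close> and \<open>1 / z - 1\<close>, which are small for \<open>z\<close> near \<open>1\<close>.
\<close>

lemma test_identity:
  assumes z: "0 < z" "z \<le> 1" and g: "\<And>s. \<bar>on12 g s\<bar> \<le> K * exp (\<delta> * work s)"
  shows "E (\<lambda>s. drift12 g s * z ^ len3 s) + lam3 * (z - 1) * E (\<lambda>s. on12 g s * z ^ len3 s)
      + mu3 * (1 / z - 1) * E (\<lambda>s. at3 s * on12 g s * z ^ len3 s) = 0"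
proof -
  have z01: "0 \<le> z ^ n" "z ^ n \<le> 1" for n
    using z by (auto simp: power_le_one)
  have 1: "integrable p (\<lambda>s. on12 g s * z ^ len3 s)"
  proof (rule dominated)
    show "\<bar>on12 g s * z ^ len3 s\<bar> \<le> K * exp (\<delta> * work s)" for s
      using mult_mono[OF g z01(2) _ z01(1), of s "len3 s"] z01[of "len3 s"] order_trans[OF abs_ge_zero g]
      by (simp add: abs_mult)
  qed
  have 2: "integrable p (\<lambda>s. at3 s * on12 g s * z ^ len3 s)"
  proof (rule Bochner_Integration.integrable_bound[OF 1])
    show "AE s in p. norm (at3 s * on12 g s * z ^ len3 s) \<le> norm (on12 g s * z ^ len3 s)"
      using indicators_01 by (auto simp: abs_mult intro!: AE_I2 mult_right_mono mult_left_le_one_le)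
  qed simp
  have 3: "drift12 g s * z ^ len3 s = generator moves (\<lambda>s. on12 g s * z ^ len3 s) s
      - lam3 * (z - 1) * (on12 g s * z ^ len3 s) - mu3 * (1 / z - 1) * (at3 s * on12 g s * z ^ len3 s)" for s
    using generator_on12[OF z(1), of g s] by simp
  show ?thesis
    unfolding 3 using 1 2 gen_int[OF 1] gen_zero[OF 1] by simp
qed

lemma expectation_cong:
  fixes f g :: "polling_state \<Rightarrow> real"
  assumes "\<And>s. consistent N s \<Longrightarrow> f s = g s"
  shows "E f = E g"
  by (intro integral_cong_AE) (auto simp: AE_measure_pmf_iff assms support_consistent)

lemma bounded_integrable:
  fixes f :: "polling_state \<Rightarrow> real"
  assumes "\<And>s. \<bar>f s\<bar> \<le> K"
  shows "integrable p f"
  by (rule measure_pmf.integrable_const_bound[where B = K]) (use assms in auto)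

definition W :: "nat \<Rightarrow> nat \<Rightarrow> real" where
  "W x1 x2 = real x1 / mu1 + real x2 / mu2"

lemma on12_W: "on12 W = work"
  by (auto simp: on12_def W_def work_def)

lemma poly_le_exp:
  assumes "0 \<le> (x :: real)"
  shows "x \<le> 1 / \<delta> * exp (\<delta> * x)" "x\<^sup>2 \<le> 2 / \<delta>\<^sup>2 * exp (\<delta> * x)"
proof -
  have "1 + \<delta> * x + (\<delta> * x)\<^sup>2 / 2 \<le> exp (\<delta> * x)"
    using exp_lower_Taylor_quadratic[of "\<delta> * x"] assms \<delta> by simp
  moreover have "0 \<le> \<delta> * x" using assms \<delta> by simp
  ultimately have "\<delta> * x \<le> exp (\<delta> * x)" "(\<delta> * x)\<^sup>2 / 2 \<le> exp (\<delta> * x)"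
    using zero_le_power2[of "\<delta> * x"] by linarith+
  then have "1 / \<delta> * (\<delta> * x) \<le> 1 / \<delta> * exp (\<delta> * x)"
    "2 / \<delta>\<^sup>2 * ((\<delta> * x)\<^sup>2 / 2) \<le> 2 / \<delta>\<^sup>2 * exp (\<delta> * x)"
    using \<delta> by (intro mult_left_mono; simp)+
  then show "x \<le> 1 / \<delta> * exp (\<delta> * x)" "x\<^sup>2 \<le> 2 / \<delta>\<^sup>2 * exp (\<delta> * x)"
    using \<delta> by (simp_all add: power_mult_distrib)
qed

lemma dominated_by_work:
  "\<bar>on12 (\<lambda>x1 x2. 1) s\<bar> \<le> 1 * exp (\<delta> * work s)"
  "\<bar>on12 (\<lambda>x1 x2. real x1) s\<bar> \<le> mu1 / \<delta> * exp (\<delta> * work s)"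
  "\<bar>on12 (\<lambda>x1 x2. real x2) s\<bar> \<le> mu2 / \<delta> * exp (\<delta> * work s)"
  "\<bar>on12 W s\<bar> \<le> 1 / \<delta> * exp (\<delta> * work s)"
  "\<bar>on12 (\<lambda>x1 x2. (W x1 x2)\<^sup>2) s\<bar> \<le> 2 / \<delta>\<^sup>2 * exp (\<delta> * work s)"
proof -
  obtain q x1 x2 x3 where s: "s = (q, x1, x2, x3)" by (rule prod_cases4)
  note pw = poly_le_exp[OF work_nonneg[of s]]
  show "\<bar>on12 (\<lambda>x1 x2. 1) s\<bar> \<le> 1 * exp (\<delta> * work s)"
    using \<delta> work_nonneg[of s] by (simp add: on12_def split_beta)
  have "real x1 / mu1 \<le> work s" "real x2 / mu2 \<le> work s"
    using pos by (auto simp: s work_def)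
  then have "real x1 \<le> mu1 * work s" "real x2 \<le> mu2 * work s"
    using pos by (auto simp: field_simps)
  moreover have "mu1 * work s \<le> mu1 * (1 / \<delta> * exp (\<delta> * work s))" "mu2 * work s \<le> mu2 * (1 / \<delta> * exp (\<delta> * work s))"
    using mult_left_mono[OF pw(1), of mu1] mult_left_mono[OF pw(1), of mu2] pos by auto
  ultimately show "\<bar>on12 (\<lambda>x1 x2. real x1) s\<bar> \<le> mu1 / \<delta> * exp (\<delta> * work s)"
    "\<bar>on12 (\<lambda>x1 x2. real x2) s\<bar> \<le> mu2 / \<delta> * exp (\<delta> * work s)"
    by (auto simp: s on12_def)
  show "\<bar>on12 W s\<bar> \<le> 1 / \<delta> * exp (\<delta> * work s)"
    using pw work_nonneg[of s] by (simp add: on12_W)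
  have "on12 (\<lambda>x1 x2. (W x1 x2)\<^sup>2) s = (work s)\<^sup>2"
    by (simp add: s on12_def W_def work_def)
  then show "\<bar>on12 (\<lambda>x1 x2. (W x1 x2)\<^sup>2) s\<bar> \<le> 2 / \<delta>\<^sup>2 * exp (\<delta> * work s)"
    using pw by simp
qed

text \<open>
  The generating functions of the third queue: \<open>G\<close> in all, \<open>G1\<close>, \<open>G2\<close>,
  \<open>G3\<close> while the server is at the respective queue, \<open>M g\<close> weighted with
  \<open>g\<close>, and \<open>M3 g\<close> weighted with \<open>g\<close> while the server is at the third queue.
\<close>

definition G :: "real \<Rightarrow> real" where "G z = E (\<lambda>s. z ^ len3 s)"
definition G1 :: "real \<Rightarrow> real" where "G1 z = E (\<lambda>s. at1 s * z ^ len3 s)"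
definition G2 :: "real \<Rightarrow> real" where "G2 z = E (\<lambda>s. at2 s * z ^ len3 s)"
definition G3 :: "real \<Rightarrow> real" where "G3 z = E (\<lambda>s. at3 s * z ^ len3 s)"
definition M :: "(nat \<Rightarrow> nat \<Rightarrow> real) \<Rightarrow> real \<Rightarrow> real" where
  "M g z = E (\<lambda>s. on12 g s * z ^ len3 s)"
definition M3 :: "(nat \<Rightarrow> nat \<Rightarrow> real) \<Rightarrow> real \<Rightarrow> real" where
  "M3 g z = E (\<lambda>s. at3 s * on12 g s * z ^ len3 s)"

lemmas gf_defs = G_def G1_def G2_def G3_def M_def M3_def

lemma integrable_weighted:
  assumes z: "0 < z" "z \<le> 1"
  shows "integrable p (\<lambda>s. z ^ len3 s)" "integrable p (\<lambda>s. at1 s * z ^ len3 s)"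
    "integrable p (\<lambda>s. at2 s * z ^ len3 s)" "integrable p (\<lambda>s. at3 s * z ^ len3 s)"
    "integrable p (\<lambda>s. idle s * z ^ len3 s)"
    and "(\<And>s. \<bar>on12 g s\<bar> \<le> K * exp (\<delta> * work s)) \<Longrightarrow> integrable p (\<lambda>s. on12 g s * z ^ len3 s)"
    and "(\<And>s. \<bar>on12 g s\<bar> \<le> K * exp (\<delta> * work s)) \<Longrightarrow> integrable p (\<lambda>s. at3 s * on12 g s * z ^ len3 s)"
    and "(\<And>s. \<bar>on12 g s\<bar> \<le> K * exp (\<delta> * work s)) \<Longrightarrow> \<bar>M g z\<bar> \<le> K * exp_moment_bound"
    and "(\<And>s. \<bar>on12 g s\<bar> \<le> K * exp (\<delta> * work s)) \<Longrightarrow> \<bar>M3 g z\<bar> \<le> K * exp_moment_bound"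
proof -
  have z01: "0 \<le> z ^ n" "z ^ n \<le> 1" for n
    using z by (auto simp: power_le_one)
  show "integrable p (\<lambda>s. z ^ len3 s)"
    using z01 by (intro bounded_integrable[of _ 1]) auto
  have "integrable p (\<lambda>s. f s * z ^ len3 s)" if "\<And>s. 0 \<le> f s \<and> f s \<le> 1" for f
    using z01 that by (intro bounded_integrable[of _ 1]) (auto simp: abs_mult intro!: mult_le_one)
  then show "integrable p (\<lambda>s. at1 s * z ^ len3 s)" "integrable p (\<lambda>s. at2 s * z ^ len3 s)"
    "integrable p (\<lambda>s. at3 s * z ^ len3 s)" "integrable p (\<lambda>s. idle s * z ^ len3 s)"
    using indicators_01 by auto
  assume g: "\<And>s. \<bar>on12 g s\<bar> \<le> K * exp (\<delta> * work s)"
  have a: "\<bar>on12 g s * z ^ len3 s\<bar> \<le> K * exp (\<delta> * work s)" for s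
  proof -
    have "\<bar>on12 g s * z ^ len3 s\<bar> \<le> \<bar>on12 g s\<bar> * 1"
      using z01[of "len3 s"] by (simp add: abs_mult mult_left_le)
    with g[of s] show ?thesis by simp
  qed
  have b: "\<bar>at3 s * on12 g s * z ^ len3 s\<bar> \<le> K * exp (\<delta> * work s)" for s
  proof -
    have "\<bar>at3 s * on12 g s * z ^ len3 s\<bar> \<le> \<bar>on12 g s * z ^ len3 s\<bar>"
      using indicators_01(5,6)[of s] by (simp add: abs_mult mult.assoc mult_left_le_one_le)
    with a[of s] show ?thesis by simp
  qed
  show "integrable p (\<lambda>s. on12 g s * z ^ len3 s)" "\<bar>M g z\<bar> \<le> K * exp_moment_bound"
    unfolding M_def using dominated[OF a] by auto
  show "integrable p (\<lambda>s. at3 s * on12 g s * z ^ len3 s)" "\<bar>M3 g z\<bar> \<le> K * exp_moment_bound"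
    unfolding M3_def using dominated[OF b] by auto
qed

text \<open>
  Test function \<open>z ^ x3\<close>.
\<close>

lemma G3_eq:
  assumes z: "0 < z" "z < 1"
  shows "mu3 * G3 z = lam3 * z * G z"
proof -
  have "drift12 (\<lambda>_ _. 1) = (\<lambda>s. 0)"
    by (auto simp: drift12_def)
  with test_identity[OF z(1) less_imp_le[OF z(2)] dominated_by_work(1)]
  have "lam3 * (z - 1) * G z + mu3 * (1 / z - 1) * G3 z = 0"
    by (simp add: G_def G3_def on12_def split_beta)
  then have "(1 - z) * (mu3 * G3 z - lam3 * z * G z) = 0"
    using z by (simp add: field_simps)
  with z show ?thesis by simp
qed

definition idle_prob :: real where "idle_prob = E idle"

text \<open>
  Test function \<open>W * z ^ x3\<close>. The workload \<open>W\<close> solves the Poisson equation of the first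
  two queues: its drift is \<open>lam1 / mu1 + lam2 / mu2\<close> minus the indicator that the server works at one
  of them, so it measures the fluctuation of the capacity that is left for the third queue. In an empty system
  \<open>z ^ x3 = 1\<close>, which produces the term \<open>idle_prob\<close>.
\<close>

lemma work_identity:
  assumes z: "0 < z" "z \<le> 1"
  shows "G3 z + idle_prob - (1 - lam1 / mu1 - lam2 / mu2) * G z
    + lam3 * (z - 1) * M W z + mu3 * (1 / z - 1) * M3 W z = 0"
proof -
  let ?b = "1 - lam1 / mu1 - lam2 / mu2"
  have "drift12 W s * z ^ len3 s = at3 s * z ^ len3 s + idle s * z ^ len3 s - ?b * z ^ len3 s" if "consistent N s" for s
  proof -
    obtain q x1 x2 x3 where s: "s = (q, x1, x2, x3)" by (rule prod_cases4)
    have "drift12 W s = lam1 / mu1 + lam2 / mu2 - at1 s - at2 s"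
      using pos by (simp add: drift12_def W_def s at1_def at2_def of_nat_diff field_simps)
    with server_somewhere[OF that] have "drift12 W s = at3 s + idle s - ?b" by simp
    then show ?thesis by (simp only: left_diff_distrib distrib_right)
  qed
  then have "E (\<lambda>s. drift12 W s * z ^ len3 s)
      = E (\<lambda>s. at3 s * z ^ len3 s + idle s * z ^ len3 s - ?b * z ^ len3 s)"
    by (rule expectation_cong)
  also have "\<dots> = G3 z + E (\<lambda>s. idle s * z ^ len3 s) - ?b * G z"
    using integrable_weighted[OF z] by (simp add: gf_defs)
  also have "E (\<lambda>s. idle s * z ^ len3 s) = idle_prob"
    unfolding idle_prob_def by (intro Bochner_Integration.integral_cong) (auto simp: idle_def len3_def)
  finally show ?thesis
    using test_identity[OF z dominated_by_work(4)] by (simp add: M_def M3_def)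
qed

text \<open>
  Test function \<open>W\<^sup>2 * z ^ x3\<close>. It gives the correlation between \<open>W\<close> and the
  server being at the third queue, the only unknown left in \<open>work_identity\<close> at first order in
  \<open>1 - z\<close>. The cross term with \<open>idle\<close> is absent because \<open>W = 0\<close> in an empty
  system.
\<close>

lemma work_squared_identity:
  assumes z: "0 < z" "z \<le> 1"
  shows "2 * (M3 W z - (1 - lam1 / mu1 - lam2 / mu2) * M W z)
    + (lam1 / mu1 / mu1 + lam2 / mu2 / mu2) * G z + G1 z / mu1 + G2 z / mu2
    + lam3 * (z - 1) * M (\<lambda>x1 x2. (W x1 x2)\<^sup>2) z + mu3 * (1 / z - 1) * M3 (\<lambda>x1 x2. (W x1 x2)\<^sup>2) z = 0"
proof -
  let ?b = "1 - lam1 / mu1 - lam2 / mu2"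
  let ?k = "lam1 / mu1 / mu1 + lam2 / mu2 / mu2"
  have "drift12 (\<lambda>x1 x2. (W x1 x2)\<^sup>2) s * z ^ len3 s
     = 2 * (at3 s * on12 W s * z ^ len3 s) - 2 * ?b * (on12 W s * z ^ len3 s)
       + ?k * z ^ len3 s + (at1 s * z ^ len3 s) / mu1 + (at2 s * z ^ len3 s) / mu2" if "consistent N s" for s
  proof -
    obtain q x1 x2 x3 where s: "s = (q, x1, x2, x3)" by (rule prod_cases4)
    let ?w = "W x1 x2"
    have up: "W (Suc x1) x2 = ?w + 1 / mu1" "W x1 (Suc x2) = ?w + 1 / mu2"
      by (auto simp: W_def add_divide_distrib)
    have down1: "at1 s * mu1 * ((W (x1 - 1) x2)\<^sup>2 - ?w\<^sup>2) = at1 s * (1 / mu1 - 2 * ?w)"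
    proof (cases "0 < x1")
      case True
      then have "W (x1 - 1) x2 = ?w - 1 / mu1" by (auto simp: W_def of_nat_diff diff_divide_distrib)
      then have "mu1 * ((W (x1 - 1) x2)\<^sup>2 - ?w\<^sup>2) = 1 / mu1 - 2 * ?w"
        using pos by (simp only:) (simp add: power2_eq_square field_simps)
      then show ?thesis by (simp only: mult.assoc)
    qed (simp add: s at1_def)
    have down2: "at2 s * mu2 * ((W x1 (x2 - 1))\<^sup>2 - ?w\<^sup>2) = at2 s * (1 / mu2 - 2 * ?w)"
    proof (cases "0 < x2")
      case True
      then have "W x1 (x2 - 1) = ?w - 1 / mu2" by (auto simp: W_def of_nat_diff diff_divide_distrib)
      then have "mu2 * ((W x1 (x2 - 1))\<^sup>2 - ?w\<^sup>2) = 1 / mu2 - 2 * ?w"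
        using pos by (simp only:) (simp add: power2_eq_square field_simps)
      then show ?thesis by (simp only: mult.assoc)
    qed (simp add: s at2_def)
    have up1: "lam1 * ((?w + 1 / mu1)\<^sup>2 - ?w\<^sup>2) = 2 * ?w * (lam1 / mu1) + lam1 / mu1 / mu1"
      and up2: "lam2 * ((?w + 1 / mu2)\<^sup>2 - ?w\<^sup>2) = 2 * ?w * (lam2 / mu2) + lam2 / mu2 / mu2"
      using pos by (auto simp: power2_eq_square field_simps)
    have "drift12 (\<lambda>x1 x2. (W x1 x2)\<^sup>2) s
       = 2 * ?w * (lam1 / mu1 + lam2 / mu2 - at1 s - at2 s) + ?k + at1 s / mu1 + at2 s / mu2"
      using up1 up2 down1 down2 unfolding up[symmetric] by (simp add: drift12_def s algebra_simps)
    also have "lam1 / mu1 + lam2 / mu2 - at1 s - at2 s = at3 s - ?b + idle s"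
      using server_somewhere[OF that] by simp
    also have "2 * ?w * (at3 s - ?b + idle s) = 2 * ?w * (at3 s - ?b)"
      by (auto simp: idle_def s W_def)
    finally have d: "drift12 (\<lambda>x1 x2. (W x1 x2)\<^sup>2) s
       = 2 * ?w * (at3 s - ?b) + ?k + at1 s / mu1 + at2 s / mu2" .
    have "on12 W s = ?w" by (simp add: on12_def s)
    moreover have "(2 * w * (a3 - b) + k + a1 / m1 + a2 / m2) * y
        = 2 * (a3 * w * y) - 2 * b * (w * y) + k * y + (a1 * y) / m1 + (a2 * y) / m2"
      for w a3 b k a1 a2 m1 m2 y :: real
      by (simp add: algebra_simps)
    ultimately show ?thesis
      unfolding d by (simp only:)
  qed
  then have "E (\<lambda>s. drift12 (\<lambda>x1 x2. (W x1 x2)\<^sup>2) s * z ^ len3 s)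
      = E (\<lambda>s. 2 * (at3 s * on12 W s * z ^ len3 s) - 2 * ?b * (on12 W s * z ^ len3 s)
       + ?k * z ^ len3 s + (at1 s * z ^ len3 s) / mu1 + (at2 s * z ^ len3 s) / mu2)"
    by (rule expectation_cong)
  also have "\<dots> = 2 * M3 W z - 2 * ?b * M W z + ?k * G z + G1 z / mu1 + G2 z / mu2"
    using integrable_weighted[OF z] integrable_weighted(6,7)[OF z dominated_by_work(4)]
    by (simp add: gf_defs)
  finally show ?thesis
    using test_identity[OF z dominated_by_work(5)] by (simp add: M_def M3_def algebra_simps)
qed

text \<open>
  Test functions \<open>x1 * z ^ x3\<close> and \<open>x2 * z ^ x3\<close>: up to terms small for \<open>z\<close>
  near \<open>1\<close>, the server is at the first two queues with the fractions of time that their loads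
  prescribe.
\<close>

lemma rate_identities:
  assumes z: "0 < z" "z \<le> 1"
  shows "lam1 * G z - mu1 * G1 z + lam3 * (z - 1) * M (\<lambda>x1 x2. real x1) z
      + mu3 * (1 / z - 1) * M3 (\<lambda>x1 x2. real x1) z = 0"
    and "lam2 * G z - mu2 * G2 z + lam3 * (z - 1) * M (\<lambda>x1 x2. real x2) z
      + mu3 * (1 / z - 1) * M3 (\<lambda>x1 x2. real x2) z = 0"
proof -
  have "drift12 (\<lambda>x1 x2. real x1) s * z ^ len3 s = lam1 * z ^ len3 s - mu1 * (at1 s * z ^ len3 s)" for s
    by (auto simp: drift12_def at1_def of_nat_diff algebra_simps split: prod.splits)
  then have "E (\<lambda>s. drift12 (\<lambda>x1 x2. real x1) s * z ^ len3 s) = lam1 * G z - mu1 * G1 z"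
    using integrable_weighted[OF z] by (simp add: gf_defs)
  then show "lam1 * G z - mu1 * G1 z + lam3 * (z - 1) * M (\<lambda>x1 x2. real x1) z
      + mu3 * (1 / z - 1) * M3 (\<lambda>x1 x2. real x1) z = 0"
    using test_identity[OF z dominated_by_work(2)] by (simp add: M_def M3_def)
  have "drift12 (\<lambda>x1 x2. real x2) s * z ^ len3 s = lam2 * z ^ len3 s - mu2 * (at2 s * z ^ len3 s)" for s
    by (auto simp: drift12_def at2_def of_nat_diff algebra_simps split: prod.splits)
  then have "E (\<lambda>s. drift12 (\<lambda>x1 x2. real x2) s * z ^ len3 s) = lam2 * G z - mu2 * G2 z"
    using integrable_weighted[OF z] by (simp add: gf_defs)
  then show "lam2 * G z - mu2 * G2 z + lam3 * (z - 1) * M (\<lambda>x1 x2. real x2) z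
      + mu3 * (1 / z - 1) * M3 (\<lambda>x1 x2. real x2) z = 0"
    using test_identity[OF z dominated_by_work(3)] by (simp add: M_def M3_def)
qed

text \<open>
  The test function \<open>x3\<close> would give at once that the server is at the third queue with probability
  \<open>lam3 / mu3\<close>, but its integrability is not known; the same follows by letting \<open>z\<close> tend
  to \<open>1\<close> in \<open>G3_eq\<close>. Then \<open>work_identity\<close> at \<open>z = 1\<close> applies.
\<close>

lemma idle_prob_eq: "idle_prob = 1 - lam1 / mu1 - lam2 / mu2 - lam3 / mu3"
proof -
  \<comment> \<open>Any sequence in \<open>]0, 1[\<close> that tends to \<open>1\<close> would do.\<close>
  define z where "z j = 1 - 1 / real (j + 2)" for j :: nat
  have z: "0 < z j" "z j < 1" for j
    by (auto simp: z_def field_simps)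
  have z_lim: "z \<longlonglongrightarrow> 1"
  proof -
    have "(\<lambda>j. 1 - inverse (real (j + 2))) \<longlonglongrightarrow> 1 - 0"
      by (intro tendsto_diff tendsto_const LIMSEQ_ignore_initial_segment lim_inverse_n)
    then show ?thesis by (simp add: z_def[abs_def] inverse_eq_divide)
  qed
  have lim: "(\<lambda>j. E (\<lambda>s. f s * z j ^ len3 s)) \<longlonglongrightarrow> E f" if f: "\<And>s. 0 \<le> f s \<and> f s \<le> 1" for f
  proof (rule integral_dominated_convergence[where w = "\<lambda>_. 1"])
    show "AE s in p. (\<lambda>j. f s * z j ^ len3 s) \<longlonglongrightarrow> f s"
    proof (rule AE_I2)
      fix s
      have "(\<lambda>j. f s * z j ^ len3 s) \<longlonglongrightarrow> f s * 1 ^ len3 s"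
        by (intro tendsto_intros z_lim)
      then show "(\<lambda>j. f s * z j ^ len3 s) \<longlonglongrightarrow> f s" by simp
    qed
    show "AE s in p. norm (f s * z j ^ len3 s) \<le> 1" for j
      using f z[of j] by (auto intro!: AE_I2 mult_le_one power_le_one simp: abs_mult less_imp_le)
  qed auto
  have "(\<lambda>j. mu3 * G3 (z j)) \<longlonglongrightarrow> mu3 * E at3"
    unfolding G3_def using lim[of at3] indicators_01 by (intro tendsto_intros) auto
  moreover have "(\<lambda>j. lam3 * z j * G (z j)) \<longlonglongrightarrow> lam3 * 1 * 1"
    unfolding G_def using lim[of "\<lambda>_. 1"] by (intro tendsto_intros z_lim) auto
  ultimately have "mu3 * E at3 = lam3"
    using LIMSEQ_unique by (simp add: G3_eq[OF z])
  moreover have "E at3 + idle_prob - (1 - lam1 / mu1 - lam2 / mu2) = 0"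
    using work_identity[of 1] by (simp add: G3_def G_def)
  ultimately show ?thesis
    using pos nonzero_mult_div_cancel_left[of mu3 "E at3"] by simp
qed

lemma G_pos: "0 < z \<Longrightarrow> z \<le> 1 \<Longrightarrow> 0 < G z"
proof -
  assume z: "0 < z" "z \<le> 1"
  obtain s where s: "s \<in> set_pmf p" using set_pmf_not_empty by fast
  have "G z \<noteq> 0"
  proof
    assume "G z = 0"
    then have "AE s in p. z ^ len3 s = 0"
      unfolding G_def using z integrable_weighted(1)[OF z]
      by (subst (asm) integral_nonneg_eq_0_iff_AE) auto
    with s z show False by (auto simp: AE_measure_pmf_iff)
  qed
  moreover have "0 \<le> G z"
    unfolding G_def using z by (intro Bochner_Integration.integral_nonneg) auto
  ultimately show "0 < G z" by simp
qed

end

section \<open>The first two queues seen as Model II\<close>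

text \<open>
  As long as the third queue is nonempty, the server being there is a vacation from the first two queues.
\<close>

definition project :: "polling_state \<Rightarrow> vacation_state" where
  "project = (\<lambda>(q, x1, x2, x3). (if q = At3 then Vacation else Working, x1, x2))"

text \<open>
  Here \<open>y\<close> is the length of the third queue after the event. If it were \<open>0\<close>, the server
  would leave the third queue and the vacation would end early.
\<close>

lemma project_moves:
  assumes "1 \<le> N" and "consistent N (q, x1, x2, x3)" and "0 < y"
  defines "m \<equiv> if q = At3 then Vacation else Working"
  shows "project (polling_move N q (Suc x1, x2, y)) = vacation_move N m (Suc x1, x2)"
    and "project (polling_move N q (x1, Suc x2, y)) = vacation_move N m (x1, Suc x2)"
    and "q = At1 \<Longrightarrow> 0 < x1 \<Longrightarrow> project (polling_move N q (x1 - 1, x2, y)) = vacation_move N m (x1 - 1, x2)"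
    and "q = At2 \<Longrightarrow> project (polling_move N q (x1, x2 - 1, y)) = vacation_move N m (x1, x2 - 1)"
    and "0 < x3 \<Longrightarrow> project (polling_move N q (x1, x2, y)) = (m, x1, x2)"
  using assms by (cases q; auto simp: project_def polling_move_def settle_def)+

context polling_system
begin

abbreviation vmoves where "vmoves \<equiv> vacation_moves N lam1 lam2 mu1 mu2"

lemma bounded_v: "bounded_moves vmoves"
  using pos by (intro bounded_vacation_moves) auto

text \<open>
  With at least two customers in the third queue, no event empties it, so the projection follows Model II exactly
  and only the change of the factor \<open>z ^ x3\<close> remains.
\<close>

lemma generator_project_interior:
  assumes z: "0 < z" "z \<le> 1" and s: "consistent N s" and len: "2 \<le> len3 s"
  shows "generator moves (\<lambda>s. indicator A (project s) * z ^ len3 s) s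
    = z ^ len3 s * generator vmoves (indicator A) (project s)
      + indicator A (project s) * z ^ len3 s * (lam3 * (z - 1) + mu3 * (1 / z - 1) * at3 s)"
proof -
  obtain q x1 x2 x3 where s_eq: "s = (q, x1, x2, x3)" by (rule prod_cases4)
  have x3: "2 \<le> x3" using len by (simp add: len3_def s_eq)
  have zx: "z ^ (x3 - Suc 0) = z ^ x3 / z"
    using x3 z by (cases x3) auto
  define m where "m = (if q = At3 then Vacation else Working)"
  have ps: "project s = (m, x1, x2)" by (simp add: project_def s_eq m_def)
  have len_move: "len3 (polling_move N q' (a, b, y)) = y" for q' a b y
    by (simp add: len3_def polling_move_def)
  note pm = project_moves[OF N s[unfolded s_eq], folded m_def]
  have pos3: "0 < x3" "0 < Suc x3" "0 < x3 - Suc 0" using x3 by auto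
  have 1: "project (polling_move N q (Suc x1, x2, x3)) = vacation_move N m (Suc x1, x2)"
    "project (polling_move N q (x1, Suc x2, x3)) = vacation_move N m (x1, Suc x2)"
    "project (polling_move N q (x1, x2, Suc x3)) = (m, x1, x2)"
    "project (polling_move N q (x1, x2, x3 - Suc 0)) = (m, x1, x2)"
    using pm(1,2)[OF pos3(1)] pm(5)[OF pos3(2) pos3(1)] pm(5)[OF pos3(3) pos3(1)] by auto
  let ?I = "indicator A :: vacation_state \<Rightarrow> real"
  define F where "F = (\<lambda>s. ?I (project s) * z ^ len3 s)"
  have Fs: "F s = ?I (m, x1, x2) * z ^ x3"
    by (simp add: F_def ps) (simp add: s_eq len3_def)
  have F_move: "F (polling_move N q' (a, b, y)) = ?I (project (polling_move N q' (a, b, y))) * z ^ y" for q' a b y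
    by (simp add: F_def len_move)
  have F1: "of_bool (q = At1 \<and> 0 < x1) * (F (polling_move N q (x1 - Suc 0, x2, x3)) - F s)
      = of_bool (m = Working \<and> 0 < x1) * (?I (vacation_move N m (x1 - Suc 0, x2)) - ?I (m, x1, x2)) * z ^ x3"
    using s[unfolded s_eq] pm(3)[OF pos3(1)] by (cases q) (auto simp: F_move Fs m_def left_diff_distrib)
  have F2: "of_bool (q = At2 \<and> 0 < x2) * (F (polling_move N q (x1, x2 - Suc 0, x3)) - F s)
      = of_bool (m = Working \<and> x1 = 0 \<and> 0 < x2) * (?I (vacation_move N m (x1, x2 - Suc 0)) - ?I (m, x1, x2)) * z ^ x3"
    using s[unfolded s_eq] pm(4)[OF pos3(1)] x3 by (cases q) (auto simp: F_move Fs m_def left_diff_distrib)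
  have "generator moves F s
    = lam1 * (F (polling_move N q (Suc x1, x2, x3)) - F s) + lam2 * (F (polling_move N q (x1, Suc x2, x3)) - F s)
    + lam3 * (F (polling_move N q (x1, x2, Suc x3)) - F s)
    + mu1 * (of_bool (q = At1 \<and> 0 < x1) * (F (polling_move N q (x1 - Suc 0, x2, x3)) - F s))
    + mu2 * (of_bool (q = At2 \<and> 0 < x2) * (F (polling_move N q (x1, x2 - Suc 0, x3)) - F s))
    + mu3 * at3 s * (F (polling_move N q (x1, x2, x3 - Suc 0)) - F s)"
    by (simp add: generator_def polling_moves_def at3_def s_eq)
  also have "\<dots> = z ^ x3 * generator vmoves ?I (m, x1, x2)
     + ?I (m, x1, x2) * z ^ x3 * (lam3 * (z - 1) + mu3 * (1 / z - 1) * at3 s)"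
    unfolding F1 F2 unfolding F_move Fs 1 zx generator_def vacation_moves_def by (simp add: algebra_simps)
  finally show ?thesis
    unfolding F_def ps by (simp add: s_eq len3_def)
qed

definition boundary_rate :: real where
  "boundary_rate = 2 * (lam1 + lam2 + lam3 + mu1 + mu2 + mu3)"

text \<open>
  Near the boundary, with at most one customer in the third queue, the two generators need not agree, but each is
  bounded by the sum of the rates.
\<close>

lemma generator_project:
  assumes z: "0 < z" "z \<le> 1" and s: "consistent N s"
  shows "\<bar>generator moves (\<lambda>s. indicator A (project s) * z ^ len3 s) s
      - z ^ len3 s * generator vmoves (indicator A) (project s)\<bar>
    \<le> lam3 * (1 - z) + mu3 * (1 / z - 1) + boundary_rate * indicator {s. len3 s \<le> 1} s"
proof (cases "2 \<le> len3 s")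
  case True
  have z01: "0 \<le> z ^ n" "z ^ n \<le> 1" for n
    using z by (auto simp: power_le_one)
  have "\<bar>indicator A (project s) * z ^ len3 s\<bar> \<le> 1"
    using z01 by (auto simp: indicator_def)
  moreover have "\<bar>lam3 * (z - 1) + mu3 * (1 / z - 1) * at3 s\<bar> \<le> lam3 * (1 - z) + mu3 * (1 / z - 1)"
  proof -
    have "\<bar>lam3 * (z - 1)\<bar> = lam3 * (1 - z)" using pos z by (simp add: abs_mult)
    moreover have nn: "0 \<le> mu3 * (1 / z - 1)" using pos z by simp
    moreover have "0 \<le> mu3 * (1 / z - 1) * at3 s" "mu3 * (1 / z - 1) * at3 s \<le> mu3 * (1 / z - 1)"
      using mult_nonneg_nonneg[OF nn indicators_01(5)] mult_left_le[OF indicators_01(6) nn] by auto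
    ultimately show ?thesis by linarith
  qed
  ultimately have "\<bar>indicator A (project s) * z ^ len3 s\<bar> * \<bar>lam3 * (z - 1) + mu3 * (1 / z - 1) * at3 s\<bar>
      \<le> 1 * (lam3 * (1 - z) + mu3 * (1 / z - 1))"
    by (intro mult_mono) auto
  with generator_project_interior[OF z s True] True show ?thesis
    by (simp add: abs_mult)
next
  case False
  have z01: "0 \<le> z ^ n" "z ^ n \<le> 1" for n
    using z by (auto simp: power_le_one)
  have "\<bar>generator moves (\<lambda>s. indicator A (project s) * z ^ len3 s) s\<bar> \<le> exit_rate moves s"
    using z01 by (intro generator_unit_bound[OF bounded]) (auto simp: indicator_def)
  also have "\<dots> \<le> lam1 + lam2 + lam3 + mu1 + mu2 + mu3"
    using pos by (cases s) (auto simp: exit_rate_def polling_moves_def intro!: add_mono)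
  finally have 1: "\<bar>generator moves (\<lambda>s. indicator A (project s) * z ^ len3 s) s\<bar>
      \<le> lam1 + lam2 + lam3 + mu1 + mu2 + mu3" .
  have "\<bar>z ^ len3 s * generator vmoves (indicator A) (project s)\<bar> \<le> \<bar>generator vmoves (indicator A) (project s)\<bar>"
    using z01[of "len3 s"] by (simp add: abs_mult mult_left_le_one_le)
  also have "\<dots> \<le> exit_rate vmoves (project s)"
    by (rule generator_indicator_bound[OF bounded_v])
  also have "\<dots> \<le> lam1 + lam2 + lam3 + mu1 + mu2 + mu3"
    using pos by (cases "project s") (auto simp: exit_rate_def vacation_moves_def)
  finally have 2: "\<bar>z ^ len3 s * generator vmoves (indicator A) (project s)\<bar>
      \<le> lam1 + lam2 + lam3 + mu1 + mu2 + mu3" .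
  have "0 \<le> lam3 * (1 - z)" "0 \<le> mu3 * (1 / z - 1)"
    using pos z by auto
  with 1 2 False show ?thesis
    by (simp add: boundary_rate_def)
qed

lemma projected_generator_bound:
  assumes z: "0 < z" "z \<le> 1"
  shows "\<bar>E (\<lambda>s. generator vmoves (indicator A) (project s) * z ^ len3 s)\<bar>
    \<le> lam3 * (1 - z) + mu3 * (1 / z - 1) + boundary_rate * measure_pmf.prob p {s. len3 s \<le> 1}"
proof -
  let ?f = "\<lambda>s. indicator A (project s) * z ^ len3 s"
  let ?g = "\<lambda>s. generator vmoves (indicator A) (project s) * z ^ len3 s"
  let ?r = "\<lambda>s. lam3 * (1 - z) + mu3 * (1 / z - 1) + boundary_rate * indicator {s. len3 s \<le> 1} s"
  have z01: "0 \<le> z ^ n" "z ^ n \<le> 1" for n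
    using z by (auto simp: power_le_one)
  have f: "integrable p ?f"
    using z01 by (intro bounded_integrable[of _ 1]) (auto simp: indicator_def)
  obtain B where B: "exit_rate vmoves v \<le> B" for v
    using exit_rate_bounded[OF bounded_v] by blast
  have g: "integrable p ?g"
  proof (rule bounded_integrable)
    fix s
    have "\<bar>?g s\<bar> \<le> \<bar>generator vmoves (indicator A) (project s)\<bar>"
      using z01[of "len3 s"] by (simp add: abs_mult mult_left_le)
    also have "\<dots> \<le> B"
      using generator_indicator_bound[OF bounded_v] B by (rule order_trans)
    finally show "\<bar>?g s\<bar> \<le> B" .
  qed
  have r: "integrable p ?r"
    by (rule bounded_integrable[of _ "\<bar>lam3 * (1 - z) + mu3 * (1 / z - 1)\<bar> + \<bar>boundary_rate\<bar>"])
       (auto simp: indicator_def)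
  have "\<bar>E ?g\<bar> = \<bar>E (\<lambda>s. ?g s - generator moves ?f s)\<bar>"
    using g gen_int[OF f] gen_zero[OF f] by simp
  also have "\<dots> \<le> E (\<lambda>s. \<bar>?g s - generator moves ?f s\<bar>)"
    by (rule integral_abs_bound)
  also have "\<dots> \<le> E ?r"
  proof (rule integral_mono_AE)
    show "AE s in p. \<bar>?g s - generator moves ?f s\<bar> \<le> ?r s"
      using generator_project[OF z, of _ A] support_consistent
      by (auto simp: AE_measure_pmf_iff abs_minus_commute mult.commute)
  qed (use g gen_int[OF f] r in auto)
  also have "\<dots> = lam3 * (1 - z) + mu3 * (1 / z - 1) + boundary_rate * measure_pmf.prob p {s. len3 s \<le> 1}"
    using bounded_integrable[of "indicator {s. len3 s \<le> 1}" 1] by simp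
  finally show ?thesis .
qed

text \<open>
  The stationary law reweighted by \<open>z ^ x3\<close>. Its projection is a probability law to which
  \<open>asymptotically_stationary_converges\<close> applies, and it carries the joint transform of the first two
  queues and the third.
\<close>

definition tilted :: "real \<Rightarrow> polling_state pmf" where
  "tilted z = embed_pmf (\<lambda>s. pmf p s * (z ^ len3 s / G z))"

lemma expectation_tilted:
  fixes f :: "polling_state \<Rightarrow> real"
  assumes z: "0 < z" "z \<le> 1"
  shows "measure_pmf.expectation (tilted z) f = E (\<lambda>s. f s * z ^ len3 s) / G z"
proof -
  note Gp = G_pos[OF z]
  have pmf: "pmf (tilted z) s = pmf p s * (z ^ len3 s / G z)" for s
    unfolding tilted_def
  proof (rule pmf_embed_pmf)
    show "0 \<le> pmf p s * (z ^ len3 s / G z)" for s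
      using z Gp by simp
    have "(\<integral>\<^sup>+ s. ennreal (pmf p s * (z ^ len3 s / G z)) \<partial>count_space UNIV)
        = (\<integral>\<^sup>+ s. ennreal (z ^ len3 s / G z) \<partial>p)"
      using z Gp by (simp add: nn_integral_measure_pmf ennreal_mult[symmetric])
    also have "\<dots> = ennreal (E (\<lambda>s. z ^ len3 s / G z))"
      using z Gp integrable_weighted(1)[OF z] by (intro nn_integral_eq_integral) auto
    also have "E (\<lambda>s. z ^ len3 s / G z) = 1"
      using Gp by (simp add: G_def)
    finally show "(\<integral>\<^sup>+ s. ennreal (pmf p s * (z ^ len3 s / G z)) \<partial>count_space UNIV) = 1"
      by simp
  qed
  have "measure_pmf.expectation (tilted z) f = (\<integral>s. pmf p s * (f s * z ^ len3 s / G z) \<partial>count_space UNIV)"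
    unfolding expectation_eq_count_space pmf by (simp add: mult_ac)
  also have "\<dots> = E (\<lambda>s. f s * z ^ len3 s / G z)"
    by (simp add: expectation_eq_count_space)
  finally show ?thesis by simp
qed

lemma prob_len3_le_1:
  assumes z: "0 < z" "z \<le> 1"
  shows "z * measure_pmf.prob p {s. len3 s \<le> 1} \<le> G z"
proof -
  let ?I = "indicator {s. len3 s \<le> 1} :: polling_state \<Rightarrow> real"
  have I: "integrable p ?I" by (rule bounded_integrable[of _ 1]) (auto simp: indicator_def)
  have "z * measure_pmf.prob p {s. len3 s \<le> 1} = E (\<lambda>s. z * ?I s)" by simp
  also have "\<dots> \<le> G z"
    unfolding G_def
  proof (rule integral_mono)
    show "z * ?I s \<le> z ^ len3 s" for s
    proof (cases "len3 s \<le> 1")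
      case True
      then have "len3 s = 0 \<or> len3 s = 1" by auto
      then show ?thesis using z by auto
    qed (use z in auto)
  qed (use I integrable_weighted(1)[OF z] in auto)
  finally show ?thesis .
qed

text \<open>
  Markov's inequality for \<open>exp (\<delta> * work)\<close> gives a majorant of the weights that is summable by
  \<open>integrable_exp_work\<close>.
\<close>

lemma pmf_tilted_project_le:
  assumes z: "0 < z" "z \<le> 1"
  shows "pmf (map_pmf project (tilted z)) (m, h, l) \<le> exp_moment_bound / G z * exp (- \<delta> * W h l)"
proof -
  have "pmf (map_pmf project (tilted z)) (m, h, l)
      = measure_pmf.expectation (tilted z) (indicator (project -` {(m, h, l)}))"
    by (simp add: pmf_map)
  also have "\<dots> = E (\<lambda>s. indicator (project -` {(m, h, l)}) s * z ^ len3 s) / G z"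
    by (rule expectation_tilted[OF z])
  also have "\<dots> \<le> (exp_moment_bound * exp (- \<delta> * W h l)) / G z"
  proof (rule divide_right_mono)
    have "E (\<lambda>s. indicator (project -` {(m, h, l)}) s * z ^ len3 s) \<le> E (\<lambda>s. exp (\<delta> * work s) * exp (- \<delta> * W h l))"
    proof (rule integral_mono)
      show "integrable p (\<lambda>s. indicator (project -` {(m, h, l)}) s * z ^ len3 s)"
        using z by (intro bounded_integrable[of _ 1]) (auto simp: indicator_def power_le_one)
      show "integrable p (\<lambda>s. exp (\<delta> * work s) * exp (- \<delta> * W h l))"
        using exp_moment(1) by simp
      fix s
      have "exp (\<delta> * work s) * exp (- \<delta> * W h l) = 1" if "project s = (m, h, l)"
        using that by (cases s) (auto simp: project_def work_def W_def exp_add[symmetric])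
      then show "indicator (project -` {(m, h, l)}) s * z ^ len3 s \<le> exp (\<delta> * work s) * exp (- \<delta> * W h l)"
        using z by (cases "project s = (m, h, l)") (auto simp: power_le_one)
    qed
    also have "\<dots> \<le> exp_moment_bound * exp (- \<delta> * W h l)"
      using exp_moment by (simp add: mult_right_mono)
    finally show "E (\<lambda>s. indicator (project -` {(m, h, l)}) s * z ^ len3 s)
      \<le> exp_moment_bound * exp (- \<delta> * W h l)" .
  qed (use G_pos[OF z] in simp)
  finally show ?thesis by simp
qed

end

lemma integrable_exp_work:
  assumes "0 < (\<delta> :: real)" "0 < mu1" "0 < mu2"
  shows "integrable (count_space UNIV) (\<lambda>(m :: mode, h :: nat, l :: nat). exp (- \<delta> * (real h / mu1 + real l / mu2)))"
proof -
  have geo: "(\<integral>\<^sup>+ n. ennreal (exp (- (a * real n))) \<partial>count_space UNIV) < \<infinity>" if "0 < a" for a :: real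
  proof -
    have "summable (\<lambda>n. exp (- a) ^ n)" using that by (intro summable_geometric) simp
    then have "summable (\<lambda>n. exp (- (a * real n)))"
      by (simp add: exp_of_nat_mult[symmetric] mult.commute)
    then show ?thesis
      by (simp add: nn_integral_count_space_nat suminf_ennreal2)
  qed
  have eq: "ennreal (exp (- \<delta> * (real h / mu1 + real l / mu2)))
      = ennreal (exp (- (\<delta> / mu1 * real h))) * ennreal (exp (- (\<delta> / mu2 * real l)))" for h l
    by (simp add: ennreal_mult[symmetric] exp_add[symmetric] algebra_simps)
  let ?f = "\<lambda>(m :: mode, h :: nat, l :: nat). ennreal (exp (- \<delta> * (real h / mu1 + real l / mu2)))"
  have "(\<integral>\<^sup>+ x. ?f x \<partial>count_space UNIV)
    = (\<integral>\<^sup>+ m. (\<integral>\<^sup>+ h. (\<integral>\<^sup>+ l. ?f (m, h, l) \<partial>count_space UNIV) \<partial>count_space UNIV) \<partial>count_space UNIV)"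
    by (simp only: nn_integral_fst_count_space[symmetric, of ?f]
        nn_integral_fst_count_space[symmetric, of "\<lambda>y. ?f (m, y)" for m])
  also have "\<dots> = (\<integral>\<^sup>+ m. (\<integral>\<^sup>+ h. ennreal (exp (- (\<delta> / mu1 * real h))) \<partial>count_space UNIV)
      * (\<integral>\<^sup>+ l. ennreal (exp (- (\<delta> / mu2 * real l))) \<partial>count_space UNIV) \<partial>count_space (UNIV :: mode set))"
    by (simp only: prod.case eq) (simp add: nn_integral_cmult nn_integral_multc)
  also have "\<dots> < \<infinity>"
  proof -
    have "(UNIV :: mode set) = {Working, Vacation}"
      using mode.exhaust by auto
    then have "finite (UNIV :: mode set)" by (metis finite.emptyI finite.insertI)
    then show ?thesis
      using geo[of "\<delta> / mu1"] geo[of "\<delta> / mu2"] assms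
      by (simp add: nn_integral_count_space_finite ennreal_mult_less_top ennreal_of_nat_eq_real_of_nat)
  qed
  finally show ?thesis
    by (intro integrableI_bounded) (auto simp: split_beta)
qed

section \<open>The heavy traffic limit\<close>

lemma tendsto_bounded_mult_zero:
  fixes f g :: "'a \<Rightarrow> real"
  assumes "(g \<longlongrightarrow> 0) F" and "\<forall>\<^sub>F x in F. \<bar>f x\<bar> \<le> K"
  shows "((\<lambda>x. g x * f x) \<longlongrightarrow> 0) F"
proof (rule Lim_null_comparison)
  show "\<forall>\<^sub>F x in F. norm (g x * f x) \<le> \<bar>g x\<bar> * K"
    using assms(2) by eventually_elim (simp add: abs_mult mult_left_mono)
  show "((\<lambda>x. \<bar>g x\<bar> * K) \<longlongrightarrow> 0) F"
    using tendsto_mult_right[OF tendsto_rabs_zero[OF assms(1)], of K] by simp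
qed

lemma exp_difference_quotient:
  "((\<lambda>\<epsilon>. (exp (a * \<epsilon>) - 1) / \<epsilon>) \<longlongrightarrow> a) (at_right (0 :: real))"
proof -
  have "((\<lambda>\<epsilon>. exp (a * \<epsilon>)) has_real_derivative a) (at 0)"
    by (auto intro!: derivative_eq_intros)
  then have "((\<lambda>\<epsilon>. (exp (a * \<epsilon>) - 1) / \<epsilon>) \<longlongrightarrow> a) (at 0)"
    by (simp add: has_field_derivative_iff)
  then show ?thesis by (rule filterlim_mono) (auto simp: at_le)
qed

text \<open>
  The load of these systems is \<open>1 - \<epsilon> * \<omega> / mu3\<close>. Their laws are constrained only for
  small \<open>\<epsilon>\<close>, so every statement about them holds eventually.
\<close>

locale heavy_traffic =
  fixes N :: nat and lam1 lam2 mu1 mu2 mu3 \<omega> \<eta> \<delta> c :: real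
    and P :: "real \<Rightarrow> polling_state pmf"
  assumes N: "1 \<le> N"
    and pos: "0 < lam1" "0 < lam2" "0 < mu1" "0 < mu2" "0 < mu3" "0 < \<omega>" "0 < \<eta>"
    and load: "lam1 / mu1 + lam2 / mu2 < 1"
    and stationary: "\<forall>\<^sub>F \<epsilon> in at_right 0.
           stationary (polling_rate N lam1 lam2
             (mu3 * (1 - lam1 / mu1 - lam2 / mu2) - \<epsilon> * \<omega>) mu1 mu2 mu3) (P \<epsilon>)"
    and \<eta>: "\<omega> / \<eta> = mu3 * (1 - lam1 / mu1 - lam2 / mu2
           + mu3 / mu1 * (lam1 / mu1) + mu3 / mu2 * (lam2 / mu2))"
    and \<delta>: "0 < \<delta>" and c: "0 < c"
    and drift1: "lam1 * (exp (\<delta> / mu1) - 1) + lam2 * (exp (\<delta> / mu2) - 1) + mu1 * (exp (- \<delta> / mu1) - 1) \<le> - c"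
    and drift2: "lam1 * (exp (\<delta> / mu1) - 1) + lam2 * (exp (\<delta> / mu2) - 1) + mu2 * (exp (- \<delta> / mu2) - 1) \<le> - c"
begin

text \<open>
  The fraction of time that the first two queues leave to the third, and the constant \<open>\<kappa>\<close> with
  which \<open>\<omega> / \<eta> = mu3 * (b + mu3 * \<kappa>)\<close>.
\<close>

definition b :: real where "b = 1 - lam1 / mu1 - lam2 / mu2"

definition \<kappa> :: real where "\<kappa> = lam1 / mu1 / mu1 + lam2 / mu2 / mu2"

definition lam3 :: "real \<Rightarrow> real" where "lam3 \<epsilon> = mu3 * b - \<epsilon> * \<omega>"

abbreviation system :: "real \<Rightarrow> bool" where
  "system \<epsilon> \<equiv> polling_system N lam1 lam2 (lam3 \<epsilon>) mu1 mu2 mu3 \<delta> c (P \<epsilon>)"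

lemma b_pos: "0 < b"
  using load by (simp add: b_def)

lemma lam3_tendsto: "(lam3 \<longlongrightarrow> mu3 * b) (at_right 0)"
  unfolding lam3_def[abs_def] by (auto intro!: tendsto_eq_intros)

lemma eventually_system: "\<forall>\<^sub>F \<epsilon> in at_right 0. 0 < \<epsilon> \<and> system \<epsilon>"
proof -
  have "\<forall>\<^sub>F \<epsilon> in at_right 0. 0 < lam3 \<epsilon>"
    using b_pos pos by (intro order_tendstoD(1)[OF lam3_tendsto]) simp
  moreover have "\<forall>\<^sub>F \<epsilon> in at_right 0. 0 < (\<epsilon> :: real)"
    by (simp add: eventually_at_right_less)
  ultimately show ?thesis
    using stationary
  proof eventually_elim
    case (elim \<epsilon>)
    then show ?case
      using N pos \<delta> c drift1 drift2
      by (auto intro!: polling_system.intro simp: lam3_def b_def)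
  qed
qed

definition bound :: real where
  "bound = polling_system.exp_moment_bound N lam1 lam2 mu1 mu2 \<delta> c"

text \<open>
  With this \<open>z\<close>, \<open>G k\<close> below is the Laplace transform of \<open>\<epsilon> * X3\<close>
  at \<open>k\<close>.
\<close>

definition z :: "nat \<Rightarrow> real \<Rightarrow> real" where "z k \<epsilon> = exp (- (real k * \<epsilon>))"

lemma z_bounds: "0 < \<epsilon> \<Longrightarrow> 0 < z k \<epsilon>" "0 < \<epsilon> \<Longrightarrow> z k \<epsilon> \<le> 1" "0 < \<epsilon> \<Longrightarrow> 0 < k \<Longrightarrow> z k \<epsilon> < 1"
  by (auto simp: z_def)

lemma z_tendsto: "(z k \<longlongrightarrow> 1) (at_right 0)"
  unfolding z_def[abs_def] by (auto intro!: tendsto_eq_intros)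

lemma z_quotients:
  "((\<lambda>\<epsilon>. (1 - z k \<epsilon>) / \<epsilon>) \<longlongrightarrow> real k) (at_right 0)"
  "((\<lambda>\<epsilon>. (1 / z k \<epsilon> - 1) / \<epsilon>) \<longlongrightarrow> real k) (at_right 0)"
proof -
  have "((\<lambda>\<epsilon>. - ((exp (- real k * \<epsilon>) - 1) / \<epsilon>)) \<longlongrightarrow> - (- real k)) (at_right 0)"
    by (intro tendsto_minus exp_difference_quotient)
  then show "((\<lambda>\<epsilon>. (1 - z k \<epsilon>) / \<epsilon>) \<longlongrightarrow> real k) (at_right 0)"
    by (simp add: z_def minus_divide_left)
  show "((\<lambda>\<epsilon>. (1 / z k \<epsilon> - 1) / \<epsilon>) \<longlongrightarrow> real k) (at_right 0)"
    using exp_difference_quotient[of "real k"] by (simp add: z_def exp_minus field_simps)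
qed

abbreviation W where "W \<equiv> polling_system.W mu1 mu2"
abbreviation G where "G k \<epsilon> \<equiv> polling_system.G (P \<epsilon>) (z k \<epsilon>)"
abbreviation G1 where "G1 k \<epsilon> \<equiv> polling_system.G1 (P \<epsilon>) (z k \<epsilon>)"
abbreviation G2 where "G2 k \<epsilon> \<equiv> polling_system.G2 (P \<epsilon>) (z k \<epsilon>)"
abbreviation G3 where "G3 k \<epsilon> \<equiv> polling_system.G3 (P \<epsilon>) (z k \<epsilon>)"
abbreviation M where "M g k \<epsilon> \<equiv> polling_system.M (P \<epsilon>) g (z k \<epsilon>)"
abbreviation M3 where "M3 g k \<epsilon> \<equiv> polling_system.M3 (P \<epsilon>) g (z k \<epsilon>)"

text \<open>
  The remainder with which a test function \<open>g\<close> enters the identities. It vanishes in the limit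
  whenever \<open>g\<close> is dominated by the exponential of the workload.
\<close>

definition R :: "(nat \<Rightarrow> nat \<Rightarrow> real) \<Rightarrow> nat \<Rightarrow> real \<Rightarrow> real" where
  "R g k \<epsilon> = lam3 \<epsilon> * (z k \<epsilon> - 1) * M g k \<epsilon> + mu3 * (1 / z k \<epsilon> - 1) * M3 g k \<epsilon>"

lemma R_tendsto:
  assumes "\<And>\<epsilon> s. system \<epsilon> \<Longrightarrow> \<bar>on12 g s\<bar> \<le> K * exp (\<delta> * polling_system.work mu1 mu2 s)"
  shows "((\<lambda>\<epsilon>. R g k \<epsilon>) \<longlongrightarrow> 0) (at_right 0)"
proof -
  have "((\<lambda>\<epsilon>. lam3 \<epsilon> * (z k \<epsilon> - 1) * M g k \<epsilon>) \<longlongrightarrow> 0) (at_right 0)"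
  proof (rule tendsto_bounded_mult_zero)
    show "((\<lambda>\<epsilon>. lam3 \<epsilon> * (z k \<epsilon> - 1)) \<longlongrightarrow> 0) (at_right 0)"
      by (auto intro!: tendsto_eq_intros z_tendsto lam3_tendsto)
    show "\<forall>\<^sub>F \<epsilon> in at_right 0. \<bar>M g k \<epsilon>\<bar> \<le> K * bound"
      using eventually_system
      by eventually_elim
        (use assms in \<open>auto simp: bound_def intro!: polling_system.integrable_weighted(8) z_bounds\<close>)
  qed
  moreover have "((\<lambda>\<epsilon>. mu3 * (1 / z k \<epsilon> - 1) * M3 g k \<epsilon>) \<longlongrightarrow> 0) (at_right 0)"
  proof (rule tendsto_bounded_mult_zero)
    show "((\<lambda>\<epsilon>. mu3 * (1 / z k \<epsilon> - 1)) \<longlongrightarrow> 0) (at_right 0)"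
      by (auto intro!: tendsto_eq_intros z_tendsto)
    show "\<forall>\<^sub>F \<epsilon> in at_right 0. \<bar>M3 g k \<epsilon>\<bar> \<le> K * bound"
      using eventually_system
      by eventually_elim
        (use assms in \<open>auto simp: bound_def intro!: polling_system.integrable_weighted(9) z_bounds\<close>)
  qed
  ultimately show ?thesis
    unfolding R_def using tendsto_add[of _ 0 _ _ 0] by fastforce
qed

text \<open>
  This solves \<open>work_squared_identity\<close> for the correlation, with \<open>G1\<close> and
  \<open>G2\<close> eliminated by \<open>rate_identities\<close>.
\<close>

lemma workload_correlation:
  "((\<lambda>\<epsilon>. M3 W k \<epsilon> - b * M W k \<epsilon> + \<kappa> * G k \<epsilon>) \<longlongrightarrow> 0) (at_right 0)"
proof -
  let ?R = "\<lambda>\<epsilon>. R (\<lambda>x1 x2. (W x1 x2)\<^sup>2) k \<epsilon> + R (\<lambda>x1 x2. real x1) k \<epsilon> / mu1 / mu1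
      + R (\<lambda>x1 x2. real x2) k \<epsilon> / mu2 / mu2"
  have "(?R \<longlongrightarrow> 0 + 0 / mu1 / mu1 + 0 / mu2 / mu2) (at_right 0)"
    using pos
    by (intro tendsto_add tendsto_divide tendsto_const
        R_tendsto[OF polling_system.dominated_by_work(5)]
        R_tendsto[OF polling_system.dominated_by_work(2)]
        R_tendsto[OF polling_system.dominated_by_work(3)]) auto
  then have "((\<lambda>\<epsilon>. ?R \<epsilon> * (- 1 / 2)) \<longlongrightarrow> 0) (at_right 0)"
    using tendsto_mult_right[of ?R 0 _ "- 1 / 2"] by simp
  then show ?thesis
  proof (rule Lim_transform_eventually)
    show "\<forall>\<^sub>F \<epsilon> in at_right 0. ?R \<epsilon> * (- 1 / 2) = M3 W k \<epsilon> - b * M W k \<epsilon> + \<kappa> * G k \<epsilon>"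
      using eventually_system
    proof eventually_elim
      case (elim \<epsilon>)
      interpret ps: polling_system N lam1 lam2 "lam3 \<epsilon>" mu1 mu2 mu3 \<delta> c "P \<epsilon>"
        using elim by simp
      have zb: "0 < z k \<epsilon>" "z k \<epsilon> \<le> 1" using elim z_bounds by auto
      note w2 = ps.work_squared_identity[OF zb, folded b_def \<kappa>_def]
      note r = ps.rate_identities[OF zb]
      have "G1 k \<epsilon> = (lam1 * G k \<epsilon> + R (\<lambda>x1 x2. real x1) k \<epsilon>) / mu1"
        "G2 k \<epsilon> = (lam2 * G k \<epsilon> + R (\<lambda>x1 x2. real x2) k \<epsilon>) / mu2"
        using r pos by (auto simp: R_def field_simps)
      then have "G1 k \<epsilon> / mu1 + G2 k \<epsilon> / mu2
          = \<kappa> * G k \<epsilon> + R (\<lambda>x1 x2. real x1) k \<epsilon> / mu1 / mu1 + R (\<lambda>x1 x2. real x2) k \<epsilon> / mu2 / mu2"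
        by (simp add: \<kappa>_def add_divide_distrib algebra_simps)
      moreover have "2 * (M3 W k \<epsilon> - b * M W k \<epsilon>) + \<kappa> * G k \<epsilon> + G1 k \<epsilon> / mu1 + G2 k \<epsilon> / mu2
          + R (\<lambda>x1 x2. (W x1 x2)\<^sup>2) k \<epsilon> = 0"
        using w2 by (simp only: R_def add.assoc)
      \<comment> \<open>With the expectations replaced by variables, the elimination is linear algebra.\<close>
      moreover have "(r + r1 + r2) * (- 1 / 2) = m3 - bm + g"
        if "a1 + a2 = g + r1 + r2" "2 * (m3 - bm) + g + a1 + a2 + r = 0" for r r1 r2 a1 a2 m3 bm g :: real
        using that by algebra
      ultimately show ?case by blast
    qed
  qed
qed

text \<open>
  The identity \<open>work_identity\<close> divided by \<open>\<epsilon>\<close>, after inserting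
  \<open>G3\<close>, the idle probability \<open>\<epsilon> * \<omega> / mu3\<close> and
  \<open>lam3 * (z - 1) = - lam3 * z * (1 / z - 1)\<close>. It is written so that the coefficient of
  \<open>G\<close> and the right-hand side both converge.
\<close>

lemma G_equation:
  assumes \<epsilon>: "0 < \<epsilon>" and sys: "system \<epsilon>" and k: "0 < k"
  shows "G k \<epsilon> * (b * ((1 - z k \<epsilon>) / \<epsilon>) + \<omega> * z k \<epsilon> / mu3 + (1 / z k \<epsilon> - 1) / \<epsilon> * (mu3 * \<kappa>))
    = \<omega> / mu3 + (1 / z k \<epsilon> - 1) / \<epsilon> *
        (mu3 * (M3 W k \<epsilon> - b * M W k \<epsilon> + \<kappa> * G k \<epsilon>) + (mu3 * b - lam3 \<epsilon> * z k \<epsilon>) * M W k \<epsilon>)"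
proof -
  interpret ps: polling_system N lam1 lam2 "lam3 \<epsilon>" mu1 mu2 mu3 \<delta> c "P \<epsilon>"
    by (rule sys)
  have zb: "0 < z k \<epsilon>" "z k \<epsilon> \<le> 1" "z k \<epsilon> < 1" using \<epsilon> k z_bounds by auto
  have G3: "G3 k \<epsilon> = lam3 \<epsilon> * z k \<epsilon> * G k \<epsilon> / mu3"
    using ps.G3_eq[OF zb(1,3)] pos by (simp add: field_simps)
  have idle: "ps.idle_prob = \<epsilon> * \<omega> / mu3"
    using pos unfolding ps.idle_prob_eq b_def[symmetric] by (simp add: lam3_def field_simps)
  \<comment> \<open>The expectations enter only through \<open>work_identity\<close>; they are replaced by variables \<open>g\<close>, \<open>m\<close>, \<open>m3\<close>.\<close>
  have alg: "g * (b * ((1 - y) / \<epsilon>) + \<omega> * y / mu3 + (1 / y - 1) / \<epsilon> * (mu3 * \<kappa>))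
      = \<omega> / mu3 + (1 / y - 1) / \<epsilon> * (mu3 * (m3 - b * m + \<kappa> * g) + (mu3 * b - lam3 \<epsilon> * y) * m)"
    if "lam3 \<epsilon> * y * g / mu3 + \<epsilon> * \<omega> / mu3 - b * g + lam3 \<epsilon> * (y - 1) * m + mu3 * (1 / y - 1) * m3 = 0"
      "0 < y" for g y m m3
  proof -
    let ?q = "1 / y - 1"
    have y1: "lam3 \<epsilon> * (y - 1) = - lam3 \<epsilon> * y * ?q" using that(2) by (simp add: field_simps)
    have l: "lam3 \<epsilon> * y * g / mu3 = (b - \<epsilon> * \<omega> / mu3) * y * g"
      using pos by (simp add: lam3_def field_simps)
    have "g * (b * (1 - y) + \<epsilon> * (\<omega> * y / mu3) + ?q * (mu3 * \<kappa>))
      = \<epsilon> * (\<omega> / mu3) + ?q * (mu3 * (m3 - b * m + \<kappa> * g) + (mu3 * b - lam3 \<epsilon> * y) * m)"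
      using that(1) unfolding y1 l by (simp add: algebra_simps)
    then have "g * (b * (1 - y) + \<epsilon> * (\<omega> * y / mu3) + ?q * (mu3 * \<kappa>)) / \<epsilon>
      = (\<epsilon> * (\<omega> / mu3) + ?q * (mu3 * (m3 - b * m + \<kappa> * g) + (mu3 * b - lam3 \<epsilon> * y) * m)) / \<epsilon>"
      by simp
    then show ?thesis
      using \<epsilon> by (simp add: add_divide_distrib distrib_left)
  qed
  show ?thesis
    using ps.work_identity[OF zb(1,2), folded b_def] zb(1) unfolding G3 idle by (intro alg)
qed

text \<open>
  In \<open>G_equation\<close> the coefficient of \<open>G\<close> tends to
  \<open>k * b + \<omega> / mu3 + k * mu3 * \<kappa> = \<omega> / mu3 * (1 + k / \<eta>)\<close> and the
  right-hand side to \<open>\<omega> / mu3\<close>. The limit is the Laplace transform of the exponential law with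
  rate \<open>\<eta>\<close>.
\<close>

lemma laplace_limit:
  "((\<lambda>\<epsilon>. G k \<epsilon>) \<longlongrightarrow> \<eta> / (\<eta> + real k)) (at_right 0)"
proof (cases "k = 0")
  case True
  have "\<forall>\<^sub>F \<epsilon> in at_right 0. \<eta> / (\<eta> + real k) = G k \<epsilon>"
    using eventually_system
  proof eventually_elim
    case (elim \<epsilon>)
    then interpret ps: polling_system N lam1 lam2 "lam3 \<epsilon>" mu1 mu2 mu3 \<delta> c "P \<epsilon>" by simp
    show ?case using True pos by (simp add: ps.G_def z_def)
  qed
  then show ?thesis by (rule Lim_transform_eventually[OF tendsto_const])
next
  case False
  let ?X = "\<lambda>\<epsilon>. b * ((1 - z k \<epsilon>) / \<epsilon>) + \<omega> * z k \<epsilon> / mu3 + (1 / z k \<epsilon> - 1) / \<epsilon> * (mu3 * \<kappa>)"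
  let ?Y = "\<lambda>\<epsilon>. \<omega> / mu3 + (1 / z k \<epsilon> - 1) / \<epsilon> *
        (mu3 * (M3 W k \<epsilon> - b * M W k \<epsilon> + \<kappa> * G k \<epsilon>) + (mu3 * b - lam3 \<epsilon> * z k \<epsilon>) * M W k \<epsilon>)"
  have rest: "((\<lambda>\<epsilon>. (mu3 * b - lam3 \<epsilon> * z k \<epsilon>) * M W k \<epsilon>) \<longlongrightarrow> 0) (at_right 0)"
  proof (rule tendsto_bounded_mult_zero)
    show "((\<lambda>\<epsilon>. mu3 * b - lam3 \<epsilon> * z k \<epsilon>) \<longlongrightarrow> 0) (at_right 0)"
      by (auto intro!: tendsto_eq_intros z_tendsto lam3_tendsto)
    show "\<forall>\<^sub>F \<epsilon> in at_right 0. \<bar>M W k \<epsilon>\<bar> \<le> 1 / \<delta> * bound"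
      using eventually_system
    proof eventually_elim
      case (elim \<epsilon>)
      then interpret ps: polling_system N lam1 lam2 "lam3 \<epsilon>" mu1 mu2 mu3 \<delta> c "P \<epsilon>" by simp
      show ?case
        using ps.integrable_weighted(8)[OF z_bounds(1,2) ps.dominated_by_work(4)] elim by (simp add: bound_def)
    qed
  qed
  have X: "(?X \<longlongrightarrow> b * real k + \<omega> * 1 / mu3 + real k * (mu3 * \<kappa>)) (at_right 0)"
    using pos by (intro tendsto_intros z_quotients z_tendsto) auto
  have Y: "(?Y \<longlongrightarrow> \<omega> / mu3 + real k * (mu3 * 0 + 0)) (at_right 0)"
    by (intro tendsto_intros z_quotients workload_correlation rest)
  have \<kappa>_pos: "0 < \<kappa>" using pos by (simp add: \<kappa>_def add_pos_pos)
  have X0: "0 < b * real k + \<omega> * 1 / mu3 + real k * (mu3 * \<kappa>)"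
    using pos b_pos \<kappa>_pos by (intro add_pos_nonneg add_nonneg_pos) auto
  have "((\<lambda>\<epsilon>. ?Y \<epsilon> / ?X \<epsilon>) \<longlongrightarrow> (\<omega> / mu3 + real k * (mu3 * 0 + 0))
      / (b * real k + \<omega> * 1 / mu3 + real k * (mu3 * \<kappa>))) (at_right 0)"
    using X0 by (intro tendsto_divide X Y) auto
  also have "(\<omega> / mu3 + real k * (mu3 * 0 + 0)) / (b * real k + \<omega> * 1 / mu3 + real k * (mu3 * \<kappa>))
      = \<eta> / (\<eta> + real k)"
  proof -
    have "\<omega> / \<eta> = mu3 * (b + mu3 * \<kappa>)"
      unfolding \<eta> by (simp add: b_def \<kappa>_def algebra_simps)
    then have "b + mu3 * \<kappa> = \<omega> / \<eta> / mu3" using pos by simp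
    moreover have "b * real k + \<omega> * 1 / mu3 + real k * (mu3 * \<kappa>) = \<omega> / mu3 + real k * (b + mu3 * \<kappa>)"
      by (simp add: algebra_simps)
    ultimately have "b * real k + \<omega> * 1 / mu3 + real k * (mu3 * \<kappa>) = \<omega> / mu3 + real k * (\<omega> / \<eta> / mu3)"
      by simp
    also have "\<dots> = \<omega> / mu3 * ((\<eta> + real k) / \<eta>)"
      using pos by (simp add: field_simps)
    finally show ?thesis using pos by simp
  qed
  finally show ?thesis
  proof (rule Lim_transform_eventually)
    have "\<forall>\<^sub>F \<epsilon> in at_right 0. 0 < ?X \<epsilon>"
      using X0 by (intro order_tendstoD(1)[OF X]) simp
    with eventually_system show "\<forall>\<^sub>F \<epsilon> in at_right 0. ?Y \<epsilon> / ?X \<epsilon> = G k \<epsilon>"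
    proof eventually_elim
      case (elim \<epsilon>)
      then show ?case using G_equation[of \<epsilon> k] False by (simp add: nonzero_divide_eq_eq)
    qed
  qed
qed

text \<open>
  The limit law has no atom at \<open>0\<close>: \<open>z\<close> times the probability is at most
  \<open>G k\<close> for every \<open>k\<close>, and \<open>\<eta> / (\<eta> + k)\<close> is arbitrarily small.
\<close>

lemma queue3_nearly_empty: "((\<lambda>\<epsilon>. measure_pmf.prob (P \<epsilon>) {s. len3 s \<le> 1}) \<longlongrightarrow> 0) (at_right 0)"
proof (rule order_tendstoI)
  fix a :: real assume "a < 0"
  then show "\<forall>\<^sub>F \<epsilon> in at_right 0. a < measure_pmf.prob (P \<epsilon>) {s. len3 s \<le> 1}"
    by (auto intro!: always_eventually elim: less_le_trans)
next
  fix a :: real assume a: "0 < a"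
  obtain k :: nat where "\<eta> / a < real k" using reals_Archimedean2 by blast
  then have "\<eta> / (\<eta> + real k) < a"
    using a pos by (simp add: field_simps add_strict_increasing)
  moreover have "((\<lambda>\<epsilon>. G k \<epsilon> / z k \<epsilon>) \<longlongrightarrow> \<eta> / (\<eta> + real k) / 1) (at_right 0)"
    by (intro tendsto_divide laplace_limit z_tendsto) simp
  ultimately have "\<forall>\<^sub>F \<epsilon> in at_right 0. G k \<epsilon> / z k \<epsilon> < a"
    by (intro order_tendstoD(2)) auto
  with eventually_system show "\<forall>\<^sub>F \<epsilon> in at_right 0. measure_pmf.prob (P \<epsilon>) {s. len3 s \<le> 1} < a"
  proof eventually_elim
    case (elim \<epsilon>)
    then interpret ps: polling_system N lam1 lam2 "lam3 \<epsilon>" mu1 mu2 mu3 \<delta> c "P \<epsilon>" by simp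
    have zb: "0 < z k \<epsilon>" "z k \<epsilon> \<le> 1" using elim z_bounds by auto
    have "measure_pmf.prob (P \<epsilon>) {s. len3 s \<le> 1} \<le> G k \<epsilon> / z k \<epsilon>"
      using ps.prob_len3_le_1[OF zb] zb by (simp add: pos_le_divide_eq mult.commute)
    with elim show ?case by simp
  qed
qed

abbreviation vmoves where "vmoves \<equiv> vacation_moves N lam1 lam2 mu1 mu2"

text \<open>
  The first two queues and the vacation indicator, under the law reweighted by
  \<open>exp (- k * \<epsilon> * X3)\<close>.
\<close>

abbreviation front :: "nat \<Rightarrow> real \<Rightarrow> vacation_state pmf" where
  "front k \<epsilon> \<equiv> map_pmf project (polling_system.tilted (P \<epsilon>) (z k \<epsilon>))"

lemma front_asymptotically_stationary:
  "((\<lambda>\<epsilon>. measure_pmf.expectation (front k \<epsilon>) (generator vmoves (indicator A))) \<longlongrightarrow> 0) (at_right 0)"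
proof (rule Lim_null_comparison)
  let ?B = "\<lambda>\<epsilon>. (lam3 \<epsilon> * (1 - z k \<epsilon>) + mu3 * (1 / z k \<epsilon> - 1)
      + 2 * (lam1 + lam2 + lam3 \<epsilon> + mu1 + mu2 + mu3) * measure_pmf.prob (P \<epsilon>) {s. len3 s \<le> 1}) / G k \<epsilon>"
  have "(?B \<longlongrightarrow> (mu3 * b * (1 - 1) + mu3 * (1 / 1 - 1) + 2 * (lam1 + lam2 + mu3 * b + mu1 + mu2 + mu3) * 0)
      / (\<eta> / (\<eta> + real k))) (at_right 0)"
    using pos by (intro tendsto_intros lam3_tendsto z_tendsto queue3_nearly_empty laplace_limit) auto
  then show "(?B \<longlongrightarrow> 0) (at_right 0)" by simp
  show "\<forall>\<^sub>F \<epsilon> in at_right 0. norm (measure_pmf.expectation (front k \<epsilon>) (generator vmoves (indicator A))) \<le> ?B \<epsilon>"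
    using eventually_system
  proof eventually_elim
    case (elim \<epsilon>)
    then interpret ps: polling_system N lam1 lam2 "lam3 \<epsilon>" mu1 mu2 mu3 \<delta> c "P \<epsilon>" by simp
    have zb: "0 < z k \<epsilon>" "z k \<epsilon> \<le> 1" using elim z_bounds by auto
    have "measure_pmf.expectation (front k \<epsilon>) (generator vmoves (indicator A))
        = measure_pmf.expectation (P \<epsilon>) (\<lambda>s. generator vmoves (indicator A) (project s) * z k \<epsilon> ^ len3 s) / G k \<epsilon>"
      by (simp add: ps.expectation_tilted[OF zb])
    then show ?case
      using ps.projected_generator_bound[OF zb, of A] ps.G_pos[OF zb]
      by (simp add: ps.boundary_rate_def divide_right_mono)
  qed
qed

lemma countable_vacation_state: "countable (UNIV :: vacation_state set)"
proof -
  have "(UNIV :: mode set) = {Working, Vacation}"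
    using mode.exhaust by auto
  then have "countable (UNIV :: mode set)"
    by (metis countable_finite finite.emptyI finite.insertI)
  then have "countable ((UNIV :: mode set) \<times> (UNIV :: (nat \<times> nat) set))"
    by (intro countable_SIGMA) auto
  then show ?thesis by simp
qed

text \<open>
  The law of the first two queues under the reweighted measure is asymptotically stationary for Model II, hence
  converges to its stationary law for every \<open>k\<close>. This is the asymptotic independence of the first two
  queues and the third.
\<close>

lemma front_tendsto:
  assumes V: "stationary (vacation_rate N lam1 lam2 mu1 mu2) V"
  shows "((\<lambda>\<epsilon>. measure_pmf.prob (front k \<epsilon>) A) \<longlongrightarrow> measure_pmf.prob V A) (at_right 0)"
  unfolding tendsto_at_iff_sequentially
proof (intro allI impI)
  fix X :: "nat \<Rightarrow> real"
  assume "\<forall>i. X i \<in> {0<..} - {0}" and X0: "X \<longlonglongrightarrow> 0"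
  then have X: "filterlim X (at_right 0) sequentially"
    by (auto simp: filterlim_at intro!: always_eventually) (metis less_irrefl)
  define a where "a = \<eta> / (\<eta> + real k)"
  have a: "0 < a" using pos by (simp add: a_def)
  have "\<forall>\<^sub>F \<epsilon> in at_right 0. a / 2 < G k \<epsilon>"
    using a by (intro order_tendstoD(1)[OF laplace_limit[of k, folded a_def]]) simp
  with eventually_system have "\<forall>\<^sub>F \<epsilon> in at_right 0. (0 < \<epsilon> \<and> system \<epsilon>) \<and> a / 2 < G k \<epsilon>"
    by (rule eventually_conj)
  then have "\<forall>\<^sub>F j in sequentially. (0 < X j \<and> system (X j)) \<and> a / 2 < G k (X j)"
    using X by (auto simp: filterlim_iff)
  \<comment> \<open>The assumptions hold only for small \<open>\<epsilon>\<close>, so the first \<open>J\<close> terms of the sequence are skipped.\<close>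
  then obtain J where J: "\<And>j. J \<le> j \<Longrightarrow> (0 < X j \<and> system (X j)) \<and> a / 2 < G k (X j)"
    by (auto simp: eventually_sequentially)
  have "(\<lambda>j. measure_pmf.prob (front k (X (j + J))) A) \<longlonglongrightarrow> measure_pmf.prob V A"
  proof (rule asymptotically_stationary_converges)
    show "countable (UNIV :: vacation_state set)" by (rule countable_vacation_state)
    show bm: "bounded_moves vmoves" using pos by (intro bounded_vacation_moves) auto
    show "(s, (Vacation, 0, 0)) \<in> (steps vmoves)\<^sup>*" for s
      using pos by (intro vacation_reaches_empty)
    show "measure_pmf.expectation V (generator vmoves (indicator A)) = 0" for A
      using V unfolding vacation_rate_eq
      by (rule stationary_generator(2)[OF _ bm])
         (rule measure_pmf.integrable_const_bound[where B = 1], auto simp: indicator_def)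
    show "(\<lambda>j. measure_pmf.expectation (front k (X (j + J))) (generator vmoves (indicator A))) \<longlonglongrightarrow> 0" for A
      using filterlim_compose[OF front_asymptotically_stationary X]
      by (rule LIMSEQ_ignore_initial_segment)
    let ?D = "\<lambda>(m :: mode, h :: nat, l :: nat). exp (- \<delta> * (real h / mu1 + real l / mu2))"
    show "integrable (count_space UNIV) (\<lambda>s. \<bar>bound\<bar> / (a / 2) * ?D s)"
      using integrable_exp_work[OF \<delta> pos(3,4)] by (intro integrable_mult_right)
    show "pmf (front k (X (j + J))) s \<le> \<bar>bound\<bar> / (a / 2) * ?D s" for j s
    proof -
      obtain m h l where s: "s = (m, h, l)" by (rule prod_cases3)
      have J': "0 < X (j + J)" "system (X (j + J))" "a / 2 < G k (X (j + J))"
        using J[of "j + J"] by auto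
      then interpret ps: polling_system N lam1 lam2 "lam3 (X (j + J))" mu1 mu2 mu3 \<delta> c "P (X (j + J))" by simp
      have "pmf (front k (X (j + J))) s \<le> bound / G k (X (j + J)) * ?D s"
        using ps.pmf_tilted_project_le[OF z_bounds(1,2)[OF J'(1)], where k1 = k and m = m and h = h and l = l]
        by (simp add: s bound_def ps.W_def)
      also have "\<dots> \<le> \<bar>bound\<bar> / (a / 2) * ?D s"
        using J'(3) a by (intro mult_right_mono frac_le) (auto simp: s)
      finally show ?thesis .
    qed
  qed
  then show "((\<lambda>\<epsilon>. measure_pmf.prob (front k \<epsilon>) A) \<circ> X) \<longlonglongrightarrow> measure_pmf.prob V A"
    unfolding o_def by (rule LIMSEQ_offset)
qed

text \<open>
  The factorization of the joint transform. The absolute value of \<open>\<epsilon>\<close> makes the exponent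
  nonpositive for every \<open>\<epsilon>\<close>, as \<open>exponential_cdf_of_moments\<close> asks.
\<close>

theorem joint_moments:
  assumes V: "stationary (vacation_rate N lam1 lam2 mu1 mu2) V"
  shows "((\<lambda>\<epsilon>. measure_pmf.expectation (P \<epsilon>) (\<lambda>s. indicator (project -` A) s * exp (- (\<bar>\<epsilon>\<bar> * real (len3 s))) ^ k))
        \<longlongrightarrow> measure_pmf.prob V A * (\<eta> / (\<eta> + real k))) (at_right 0)"
proof (rule Lim_transform_eventually)
  show "((\<lambda>\<epsilon>. measure_pmf.prob (front k \<epsilon>) A * G k \<epsilon>) \<longlongrightarrow> measure_pmf.prob V A * (\<eta> / (\<eta> + real k))) (at_right 0)"
    by (intro tendsto_mult front_tendsto[OF V] laplace_limit)
  show "\<forall>\<^sub>F \<epsilon> in at_right 0. measure_pmf.prob (front k \<epsilon>) A * G k \<epsilon>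
    = measure_pmf.expectation (P \<epsilon>) (\<lambda>s. indicator (project -` A) s * exp (- (\<bar>\<epsilon>\<bar> * real (len3 s))) ^ k)"
    using eventually_system
  proof eventually_elim
    case (elim \<epsilon>)
    then interpret ps: polling_system N lam1 lam2 "lam3 \<epsilon>" mu1 mu2 mu3 \<delta> c "P \<epsilon>" by simp
    have zb: "0 < z k \<epsilon>" "z k \<epsilon> \<le> 1" using elim z_bounds by auto
    have pow: "z k \<epsilon> ^ n = exp (- (\<bar>\<epsilon>\<bar> * real n)) ^ k" for n
      using elim by (simp add: z_def exp_of_nat_mult[symmetric] mult_ac)
    have "measure_pmf.prob (front k \<epsilon>) A
        = measure_pmf.expectation (ps.tilted (z k \<epsilon>)) (indicator (project -` A))"
      by (simp add: measure_map_pmf)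
    also have "\<dots> = measure_pmf.expectation (P \<epsilon>) (\<lambda>s. indicator (project -` A) s * z k \<epsilon> ^ len3 s) / G k \<epsilon>"
      by (rule ps.expectation_tilted[OF zb])
    finally show ?case
      using ps.G_pos[OF zb] by (simp add: pow)
  qed
qed

end

theorem theorem1:
  fixes lam1 lam2 mu1 mu2 mu3 \<omega> \<eta> \<zeta> :: real
    and N x1 x2 :: nat
    and P :: "real \<Rightarrow> polling_state pmf"
    and V :: "vacation_state pmf"
  assumes "lam1 > 0" "lam2 > 0" "mu1 > 0" "mu2 > 0" "mu3 > 0"
    and "lam1 / mu1 + lam2 / mu2 < 1"
    and "N \<ge> 1" and "\<omega> > 0"
    and "\<forall>\<^sub>F \<epsilon> in at_right 0.
           stationary (polling_rate N lam1 lam2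
             (mu3 * (1 - lam1 / mu1 - lam2 / mu2) - \<epsilon> * \<omega>) mu1 mu2 mu3) (P \<epsilon>)"
    and "stationary (vacation_rate N lam1 lam2 mu1 mu2) V"
    and "\<eta> > 0"
    and "\<omega> / \<eta> = mu3 * (1 - lam1 / mu1 - lam2 / mu2
           + mu3 / mu1 * (lam1 / mu1) + mu3 / mu2 * (lam2 / mu2))"
    and "\<zeta> > 0"
  shows "((\<lambda>\<epsilon>. measure_pmf.prob (P \<epsilon>)
            {(p, n1, n2, n3). n1 \<le> x1 \<and> n2 \<le> x2 \<and> \<epsilon> * real n3 \<le> \<zeta>})
          \<longlongrightarrow> vacation_cdf V x1 x2 * (1 - exp (- \<eta> * \<zeta>))) (at_right 0)"
proof -
  obtain \<delta> c where dc: "0 < \<delta>" "0 < c"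
    "lam1 * (exp (\<delta> / mu1) - 1) + lam2 * (exp (\<delta> / mu2) - 1) + mu1 * (exp (- \<delta> / mu1) - 1) \<le> - c"
    "lam1 * (exp (\<delta> / mu1) - 1) + lam2 * (exp (\<delta> / mu2) - 1) + mu2 * (exp (- \<delta> / mu2) - 1) \<le> - c"
    using exponential_drift_rate[OF assms(3,4,6)] by metis
  interpret heavy_traffic N lam1 lam2 mu1 mu2 mu3 \<omega> \<eta> \<delta> c P
    using assms dc by unfold_locales auto
  let ?A = "{(m :: mode, h, l). h \<le> x1 \<and> l \<le> x2}"
  have "((\<lambda>\<epsilon>. measure_pmf.prob (P \<epsilon>) {s \<in> project -` ?A. \<bar>\<epsilon>\<bar> * real (len3 s) \<le> \<zeta>})
      \<longlongrightarrow> measure_pmf.prob V ?A * (1 - exp (- \<eta> * \<zeta>))) (at_right 0)"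
    by (rule exponential_cdf_of_moments[OF \<open>0 < \<eta>\<close> _ _ joint_moments[OF assms(10)] \<open>0 < \<zeta>\<close>]) auto
  then show ?thesis
    unfolding vacation_cdf_def
  proof (rule Lim_transform_eventually)
    have "\<forall>\<^sub>F \<epsilon> in at_right 0. 0 < (\<epsilon> :: real)"
      by (simp add: eventually_at_right_less)
    then show "\<forall>\<^sub>F \<epsilon> in at_right 0.
        measure_pmf.prob (P \<epsilon>) {s \<in> project -` ?A. \<bar>\<epsilon>\<bar> * real (len3 s) \<le> \<zeta>}
      = measure_pmf.prob (P \<epsilon>) {(p, n1, n2, n3). n1 \<le> x1 \<and> n2 \<le> x2 \<and> \<epsilon> * real n3 \<le> \<zeta>}"
      by eventually_elim (auto intro!: arg_cong[where f = "measure_pmf.prob _"] simp: project_def len3_def)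
  qed
qed

end
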